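(* Let $V$ be a finite-dimensional $\mathbb{R}$-vector space, let $K\subseteq\mathbb{R}$ be a subfield, and let $W$ be a $K$-structure on $V$. Every $W$-polycone in $V$ has a $W$-decomposition, and a $W$-polycone has a unique $W$-decomposition if and only if it is sharp or a line (i.e. a $1$-dimensional linear subspace).
   Context: A $K$-structure on $V$ is a sub-$K$-vector space $W\subseteq V$ such that the canonical map $\mathbb{R}\otimes_K W\to V$ is an isomorphism. A subspace of $V$ is $W$-rational if it has a basis contained in $W$. A $W$-polycone is the intersection of finitely many closed linear halfspaces bounded by $W$-rational linear hyperplanes (equivalently, the conic hull of a finite subset of $W$); it is sharp if it contains no line. For a family $(\sigma_i)_{i\in I}$ of $W$-polycones, the sum $\sum_{i\in I}\sigma_i$ is called direct, and written $\bigoplus_{i\in I}\sigma_i$, if the sum of $\mathbb{R}$-vector spaces $\sum_{i\in I}\langle\sigma_i\rangle$ is direct, where $\langle\cdot\rangle$ denotes linear span. A $W$-polycone is $W$-decomposable if it is the direct sum of two $W$-polycones different from $0$, and $W$-indecomposable otherwise. A $W$-decomposition of a $W$-polycone $\sigma$ is a set $Z$ of $W$-indecomposable $W$-polycones different from $0$ such that $\sigma=\bigoplus_{\tau\in Z}\tau$ (for $\sigma=0$ the empty set is allowed). *)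

theory Defs
  imports Complex_Main "HOL-Algebra.Free_Abelian_Groups"
begin

definition is_subfield :: "real set \<Rightarrow> bool" where
  "is_subfield K \<longleftrightarrow> 0 \<in> K \<and> 1 \<in> K \<and>
     (\<forall>x\<in>K. \<forall>y\<in>K. x + y \<in> K \<and> x * y \<in> K) \<and> (\<forall>x\<in>K. - x \<in> K \<and> inverse x \<in> K)"

definition K_subspace :: "real set \<Rightarrow> 'a::real_vector set \<Rightarrow> bool" where
  "K_subspace K W \<longleftrightarrow> 0 \<in> W \<and> (\<forall>v\<in>W. \<forall>w\<in>W. v + w \<in> W) \<and> (\<forall>k\<in>K. \<forall>w\<in>W. k *\<^sub>R w \<in> W)"

text \<open>
  The tensor product of the real line and \<open>W\<close> over \<open>K\<close>: the free abelian group on the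
  pairs \<open>(r, w)\<close>, modulo the subgroup generated by the biadditivity and \<open>K\<close>-balancedness relations.
\<close>

definition tensor_relations :: "real set \<Rightarrow> 'a::real_vector set \<Rightarrow> ((real \<times> 'a) \<Rightarrow>\<^sub>0 int) set" where
  "tensor_relations K W =
     {frag_of (r + s, w) - frag_of (r, w) - frag_of (s, w) | r s w. w \<in> W} \<union>
     {frag_of (r, v + w) - frag_of (r, v) - frag_of (r, w) | r v w. v \<in> W \<and> w \<in> W} \<union>
     {frag_of (r * k, w) - frag_of (r, k *\<^sub>R w) | r k w. k \<in> K \<and> w \<in> W}"

definition real_tensor ::
    "real set \<Rightarrow> 'a::real_vector set \<Rightarrow> ((real \<times> 'a) \<Rightarrow>\<^sub>0 int) set monoid" where
  "real_tensor K W =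
     free_Abelian_group (UNIV \<times> W) Mod
       generate (free_Abelian_group (UNIV \<times> W)) (tensor_relations K W)"

definition tensor_eval :: "((real \<times> 'a::real_vector) \<Rightarrow>\<^sub>0 int) \<Rightarrow> 'a" where
  "tensor_eval c =
     (\<Sum>p\<in>Poly_Mapping.keys c. of_int (Poly_Mapping.lookup c p) *\<^sub>R (fst p *\<^sub>R snd p))"

text \<open>
  The canonical map sends the class of \<open>(r, w)\<close> to \<open>r *\<^sub>R w\<close>; \<open>tensor_eval\<close> is constant on the
  classes (elements of the tensor product are cosets). The canonical map is linear for the real
  scalar multiplication on the first tensor factor, so it is an isomorphism iff it is bijective.
\<close>

definition canonical_map :: "((real \<times> 'a::real_vector) \<Rightarrow>\<^sub>0 int) set \<Rightarrow> 'a" where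
  "canonical_map C = the_elem (tensor_eval ` C)"

definition K_structure :: "real set \<Rightarrow> 'a::real_vector set \<Rightarrow> bool" where
  "K_structure K W \<longleftrightarrow>
     K_subspace K W \<and> bij_betw canonical_map (carrier (real_tensor K W)) UNIV"

definition rational_subspace :: "'a::real_vector set \<Rightarrow> 'a set \<Rightarrow> bool" where
  "rational_subspace W U \<longleftrightarrow> (\<exists>B. B \<subseteq> W \<and> independent B \<and> span B = U)"

definition rational_halfspace :: "'a::real_vector set \<Rightarrow> 'a set \<Rightarrow> bool" where
  "rational_halfspace W h \<longleftrightarrow>
     (\<exists>f::'a \<Rightarrow> real. linear f \<and> (\<exists>x. f x \<noteq> 0) \<and>
        rational_subspace W {x. f x = 0} \<and> h = {x. f x \<ge> 0})"

text \<open>The empty intersection is the whole space.\<close>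

definition polycone :: "'a::real_vector set \<Rightarrow> 'a set \<Rightarrow> bool" where
  "polycone W \<sigma> \<longleftrightarrow> (\<exists>H. finite H \<and> (\<forall>h\<in>H. rational_halfspace W h) \<and> \<sigma> = \<Inter>H)"

definition is_line :: "'a::real_vector set \<Rightarrow> bool" where
  "is_line L \<longleftrightarrow> subspace L \<and> dim L = 1"

definition sharp :: "'a::real_vector set \<Rightarrow> bool" where
  "sharp \<sigma> \<longleftrightarrow> \<not> (\<exists>L. is_line L \<and> L \<subseteq> \<sigma>)"

text \<open>
  Sums of arbitrary families of cones: all sums of finitely many elements. The empty family
  has sum \<open>{0}\<close>.
\<close>

definition family_sum :: "'i set \<Rightarrow> ('i \<Rightarrow> 'a::real_vector set) \<Rightarrow> 'a set" where
  "family_sum I S = {\<Sum>i\<in>J. x i | J x. finite J \<and> J \<subseteq> I \<and> (\<forall>i\<in>J. x i \<in> S i)}"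

definition direct_family :: "'i set \<Rightarrow> ('i \<Rightarrow> 'a::real_vector set) \<Rightarrow> bool" where
  "direct_family I S \<longleftrightarrow>
     (\<forall>J x. finite J \<and> J \<subseteq> I \<and> (\<forall>i\<in>J. x i \<in> span (S i)) \<and> (\<Sum>i\<in>J. x i) = 0
        \<longrightarrow> (\<forall>i\<in>J. x i = 0))"

definition is_direct_sum :: "'a::real_vector set \<Rightarrow> 'i set \<Rightarrow> ('i \<Rightarrow> 'a set) \<Rightarrow> bool" where
  "is_direct_sum \<sigma> I S \<longleftrightarrow> direct_family I S \<and> \<sigma> = family_sum I S"

definition decomposable :: "'a::real_vector set \<Rightarrow> 'a set \<Rightarrow> bool" where
  "decomposable W \<sigma> \<longleftrightarrow>
     (\<exists>\<tau> \<rho>. polycone W \<tau> \<and> polycone W \<rho> \<and> \<tau> \<noteq> {0} \<and> \<rho> \<noteq> {0} \<and>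
        is_direct_sum \<sigma> UNIV (\<lambda>b::bool. if b then \<tau> else \<rho>))"

definition decomposition :: "'a::real_vector set \<Rightarrow> 'a set \<Rightarrow> 'a set set \<Rightarrow> bool" where
  "decomposition W \<sigma> Z \<longleftrightarrow>
     (\<forall>\<tau>\<in>Z. polycone W \<tau> \<and> \<not> decomposable W \<tau> \<and> \<tau> \<noteq> {0}) \<and>
     is_direct_sum \<sigma> Z (\<lambda>\<tau>. \<tau>)"

end

theory Submission
  imports Defs "HOL-Analysis.Convex"
begin

text \<open>
  Bijectivity of the canonical map means that \<open>W\<close> spans \<open>V\<close> and that every element of \<open>W\<close> has
  coordinates in \<open>K\<close> with respect to linearly independent vectors of \<open>W\<close>. Hence polycones are the
  solution sets of finitely many inequalities \<open>f \<ge> 0\<close> with \<open>f(W) \<subseteq> K\<close>, their faces are polycones,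
  and their spans and lineality spaces are spanned by elements of \<open>W\<close>.

  Decompositions exist by induction on the dimension. In a sharp polycone direct summands are faces,
  so intersecting the members of one decomposition with those of another decomposes them further;
  by indecomposability the two decompositions coincide. A non-sharp indecomposable polycone
  splits off a rational line and is therefore a line. If a non-sharp polycone is not a line,
  a shear along a rational line in one member of a decomposition, moving another member,
  produces a second decomposition.
\<close>

subsection \<open>Consequences of the tensor product description\<close>

text \<open>Coefficients in \<open>K\<close> are detected by test maps. A \<open>K\<close>-linear
  \<psi> on \<open>W\<close> gives a map sending (r, w) to r * \<psi>(w), which respects the tensor
  relations, so injectivity of the canonical map makes \<psi> respect every real linear relation
  among vectors of \<open>W\<close>. Polycones are handled by inequalities throughout and never by
  generators. So the sum of the other members of a decomposition is available only as a convex cone,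
  not as a polycone. This is why faces matter: a face is cut out by those defining functionals that
  vanish on it. Sharpness turns direct summands into faces, because if a + b lies in one summand,
  then the complementary components of a and b are opposite vectors of the cone and must vanish. The
  shear adds to a rational vector in the span of one member a rational vector on a line inside
  another. The result has two nonzero components, so it lies in the span of no single
  member.\<close>

definition frag_eval :: "('b \<Rightarrow> 'v::real_vector) \<Rightarrow> ('b \<Rightarrow>\<^sub>0 int) \<Rightarrow> 'v" where
  "frag_eval \<phi> c = (\<Sum>p\<in>Poly_Mapping.keys c. of_int (Poly_Mapping.lookup c p) *\<^sub>R \<phi> p)"

section \<open>Additive extensions to the free abelian group\<close>

lemma frag_eval_superset:
  assumes "finite A" "Poly_Mapping.keys c \<subseteq> A"
  shows "frag_eval \<phi> c = (\<Sum>p\<in>A. of_int (Poly_Mapping.lookup c p) *\<^sub>R \<phi> p)"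
  unfolding frag_eval_def using assms
  by (intro sum.mono_neutral_left) (auto simp: in_keys_iff)

lemma frag_eval_add: "frag_eval \<phi> (c + d) = frag_eval \<phi> c + frag_eval \<phi> d"
proof -
  let ?A = "Poly_Mapping.keys c \<union> Poly_Mapping.keys d"
  have "frag_eval \<phi> e = (\<Sum>p\<in>?A. of_int (Poly_Mapping.lookup e p) *\<^sub>R \<phi> p)"
    if "Poly_Mapping.keys e \<subseteq> ?A" for e
    using that by (intro frag_eval_superset) auto
  then show ?thesis
    using keys_add[of c d] by (simp add: lookup_add scaleR_left_distrib sum.distrib)
qed

lemma frag_eval_minus: "frag_eval \<phi> (- c) = - frag_eval \<phi> c"
  by (simp add: frag_eval_def sum_negf)

lemma frag_eval_diff: "frag_eval \<phi> (c - d) = frag_eval \<phi> c - frag_eval \<phi> d"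
  using frag_eval_add[of \<phi> c "- d"] by (simp add: frag_eval_minus)

lemma frag_eval_0 [simp]: "frag_eval \<phi> 0 = 0"
  by (simp add: frag_eval_def)

lemma frag_eval_of [simp]: "frag_eval \<phi> (frag_of p) = \<phi> p"
  by (simp add: frag_eval_def)

lemma frag_eval_sum: "frag_eval \<phi> (\<Sum>i\<in>I. c i) = (\<Sum>i\<in>I. frag_eval \<phi> (c i))"
  by (induction I rule: infinite_finite_induct) (simp_all add: frag_eval_add)

lemma tensor_eval_eq_frag_eval: "tensor_eval = frag_eval (\<lambda>p. fst p *\<^sub>R snd p)"
  by (rule ext) (simp add: tensor_eval_def frag_eval_def)

text \<open>These are exactly the maps whose additive extension kills
  \<open>tensor_relations\<close>, hence factors through the tensor product. The target is arbitrary
  because two such maps occur: (r, w) to r w, and a real-valued test map built from a functional on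
  \<open>W\<close>.\<close>

definition balanced :: "real set \<Rightarrow> 'a::real_vector set \<Rightarrow> (real \<times> 'a \<Rightarrow> 'v::real_vector) \<Rightarrow> bool" where
  "balanced K W \<phi> \<longleftrightarrow>
     (\<forall>r s. \<forall>w\<in>W. \<phi> (r + s, w) = \<phi> (r, w) + \<phi> (s, w)) \<and>
     (\<forall>r. \<forall>v\<in>W. \<forall>w\<in>W. \<phi> (r, v + w) = \<phi> (r, v) + \<phi> (r, w)) \<and>
     (\<forall>r. \<forall>k\<in>K. \<forall>w\<in>W. \<phi> (r * k, w) = \<phi> (r, k *\<^sub>R w))"

section \<open>Maps on the tensor product and the canonical map\<close>

lemma tensor_relations_subset:
  assumes "K_subspace K W"
  shows "tensor_relations K W \<subseteq> carrier (free_Abelian_group (UNIV \<times> W))"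
  using assms unfolding tensor_relations_def K_subspace_def
  by (auto simp: keys_frag_of dest!: keys_diff[THEN subsetD])

lemma frag_eval_generate_relations:
  assumes "K_subspace K W" "balanced K W \<phi>"
    and "c \<in> generate (free_Abelian_group (UNIV \<times> W)) (tensor_relations K W)"
  shows "frag_eval \<phi> c = 0"
proof -
  have rel: "frag_eval \<phi> h = 0" if "h \<in> tensor_relations K W" for h
    using that assms(2) unfolding tensor_relations_def balanced_def
    by (auto simp: frag_eval_diff)
  from assms(3) show ?thesis
  proof (induction rule: generate.induct)
    case (inv h)
    \<comment> \<open>The group inverse of \<open>h\<close> is known to be \<open>- h\<close> only
      for \<open>h\<close> in the carrier, so the support has to be checked.\<close>
    then have "Poly_Mapping.keys h \<subseteq> UNIV \<times> W"
      using subsetD[OF tensor_relations_subset[OF assms(1)]] by simp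
    then show ?case
      using rel[OF inv] by (simp add: frag_eval_minus)
  qed (simp_all add: rel frag_eval_add)
qed

lemma balanced_scaleR: "balanced K W (\<lambda>p. fst p *\<^sub>R snd p)"
  by (auto simp: balanced_def scaleR_left_distrib scaleR_right_distrib)

text \<open>\<open>tensor_eval\<close> vanishes on the subgroup of relations, so it sends a coset to
  a singleton and \<open>the_elem\<close> returns a genuine value.\<close>

lemma canonical_map_coset:
  assumes "K_subspace K W" "Poly_Mapping.keys c \<subseteq> UNIV \<times> W"
  defines "G \<equiv> free_Abelian_group (UNIV \<times> W)"
  shows "canonical_map (generate G (tensor_relations K W) #>\<^bsub>G\<^esub> c) = tensor_eval c"
proof -
  let ?N = "generate G (tensor_relations K W)"
  have "tensor_eval (h + c) = tensor_eval c" if "h \<in> ?N" for h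
    using frag_eval_generate_relations[OF assms(1) balanced_scaleR] that
    by (simp add: tensor_eval_eq_frag_eval frag_eval_add G_def)
  moreover have "0 \<in> ?N"
    using generate.one[of G] by (simp add: G_def)
  ultimately have "tensor_eval ` (?N #>\<^bsub>G\<^esub> c) = {tensor_eval c}"
    by (force simp: r_coset_def G_def)
  then show ?thesis
    by (simp add: canonical_map_def)
qed

text \<open>The cosets of \<open>c\<close> and of 0 have the same image under the canonical map, so
  injectivity identifies them. This is the only form in which injectivity is used later.\<close>

lemma tensor_eval_kernel:
  assumes "K_structure K W" "Poly_Mapping.keys c \<subseteq> UNIV \<times> W" "tensor_eval c = 0"
  shows "c \<in> generate (free_Abelian_group (UNIV \<times> W)) (tensor_relations K W)"
proof -
  define G where "G = free_Abelian_group ((UNIV :: real set) \<times> W)"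
  define N where "N = generate G (tensor_relations K W)"
  have KW: "K_subspace K W" and bij: "bij_betw canonical_map (carrier (real_tensor K W)) UNIV"
    using assms(1) by (auto simp: K_structure_def)
  have "group G"
    by (simp add: G_def)
  have N: "subgroup N G"
    unfolding N_def using tensor_relations_subset[OF KW]
    by (intro group.generate_is_subgroup \<open>group G\<close>) (simp add: G_def)
  have coset: "N #>\<^bsub>G\<^esub> d \<in> carrier (real_tensor K W)" if "d \<in> carrier G" for d
    using that unfolding real_tensor_def FactGroup_def RCOSETS_def N_def G_def by auto
  have c: "c \<in> carrier G" "0 \<in> carrier G"
    using assms(2) by (auto simp: G_def)
  have "canonical_map (N #>\<^bsub>G\<^esub> c) = canonical_map (N #>\<^bsub>G\<^esub> 0)"
    using canonical_map_coset[OF KW assms(2)] canonical_map_coset[OF KW, of 0] assms(3)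
    by (simp add: N_def G_def tensor_eval_eq_frag_eval)
  then have "N #>\<^bsub>G\<^esub> c = N #>\<^bsub>G\<^esub> 0"
    using bij_betw_imp_inj_on[OF bij] coset c by (meson inj_onD)
  moreover have "N #>\<^bsub>G\<^esub> 0 = N"
    using group.coset_mult_one[OF \<open>group G\<close>, of N] subgroup.subset[OF N]
    by (simp add: G_def)
  moreover have "c \<in> N #>\<^bsub>G\<^esub> c"
    using group.rcos_self[OF \<open>group G\<close> c(1) N] .
  ultimately show ?thesis
    by (simp add: N_def G_def)
qed

text \<open>This is surjectivity of the canonical map: each vector is the value of a finite formal
  sum of pairs whose second entries lie in \<open>W\<close>.\<close>

lemma K_structure_span:
  assumes "K_structure K W"
  shows "span W = UNIV"
proof (intro equalityI subset_UNIV subsetI)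
  fix v
  have KW: "K_subspace K W" and bij: "bij_betw canonical_map (carrier (real_tensor K W)) UNIV"
    using assms by (auto simp: K_structure_def)
  then obtain C where C: "C \<in> carrier (real_tensor K W)" "v = canonical_map C"
    by (metis UNIV_I bij_betw_imp_surj_on imageE)
  then obtain c where c: "Poly_Mapping.keys c \<subseteq> UNIV \<times> W"
    "C = generate (free_Abelian_group (UNIV \<times> W)) (tensor_relations K W)
           #>\<^bsub>free_Abelian_group (UNIV \<times> W)\<^esub> c"
    unfolding real_tensor_def FactGroup_def RCOSETS_def by auto
  have "v = tensor_eval c"
    using canonical_map_coset[OF KW c(1)] c(2) C(2) by simp
  also have "\<dots> \<in> span W"
    unfolding tensor_eval_def using c(1)
    by (intro span_sum span_scale) (force intro: span_base)
  finally show "v \<in> span W" .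
qed

text \<open>A \<open>K\<close>-subspace \<open>M\<close> of \<open>W\<close> that is maximal among those avoiding \<open>w\<close> satisfies \<open>W = M \<oplus> K w\<close>.\<close>

lemma exists_K_functional:
  assumes K: "is_subfield K" and W: "K_subspace K W" and M0: "K_subspace K M0" "M0 \<subseteq> W"
    and w: "w \<in> W" "w \<notin> M0"
  obtains \<psi> :: "'a::real_vector \<Rightarrow> real" where
    "\<And>u v. u \<in> W \<Longrightarrow> v \<in> W \<Longrightarrow> \<psi> (u + v) = \<psi> u + \<psi> v"
    "\<And>k v. k \<in> K \<Longrightarrow> v \<in> W \<Longrightarrow> \<psi> (k *\<^sub>R v) = k * \<psi> v"
    "\<And>v. v \<in> M0 \<Longrightarrow> \<psi> v = 0" "\<psi> w = 1"
proof -
  have K': "0 \<in> K" "1 \<in> K" "\<And>x y. x \<in> K \<Longrightarrow> y \<in> K \<Longrightarrow> x + y \<in> K"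
    "\<And>x y. x \<in> K \<Longrightarrow> y \<in> K \<Longrightarrow> x * y \<in> K" "\<And>x. x \<in> K \<Longrightarrow> - x \<in> K" "\<And>x. x \<in> K \<Longrightarrow> inverse x \<in> K"
    using K unfolding is_subfield_def by auto
  define \<A> where "\<A> = {M. K_subspace K M \<and> M0 \<subseteq> M \<and> M \<subseteq> W \<and> w \<notin> M}"
  have "\<exists>M\<in>\<A>. \<forall>X\<in>\<A>. M \<subseteq> X \<longrightarrow> X = M"
  proof (rule subset_Zorn_nonempty)
    show "\<A> \<noteq> {}"
      using assms by (auto simp: \<A>_def)
    fix \<C> assume C: "\<C> \<noteq> {}" "subset.chain \<A> \<C>"
    then have *: "\<And>X. X \<in> \<C> \<Longrightarrow> K_subspace K X \<and> M0 \<subseteq> X \<and> X \<subseteq> W \<and> w \<notin> X"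
      by (auto simp: subset.chain_def \<A>_def)
    have "K_subspace K (\<Union>\<C>)"
      unfolding K_subspace_def
    proof (intro conjI ballI)
      show "0 \<in> \<Union>\<C>"
        using C(1) * by (auto simp: K_subspace_def)
      show "k *\<^sub>R v \<in> \<Union>\<C>" if "k \<in> K" "v \<in> \<Union>\<C>" for k v
        using that * unfolding K_subspace_def by blast
      show "u + v \<in> \<Union>\<C>" if uv: "u \<in> \<Union>\<C>" "v \<in> \<Union>\<C>" for u v
      proof -
        obtain X Y where XY: "X \<in> \<C>" "u \<in> X" "Y \<in> \<C>" "v \<in> Y"
          using uv by blast
        then obtain U where "U \<in> \<C>" "u \<in> U" "v \<in> U"
          using C(2) by (metis subset.chain_def subsetD subset_chain_def)
        then show ?thesis
          using * unfolding K_subspace_def by blast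
      qed
    qed
    then show "\<Union>\<C> \<in> \<A>"
      using C(1) * by (auto simp: \<A>_def)
  qed
  then obtain M where M: "K_subspace K M" "M0 \<subseteq> M" "M \<subseteq> W" "w \<notin> M"
    and max: "\<And>X. X \<in> \<A> \<Longrightarrow> M \<subseteq> X \<Longrightarrow> X = M"
    by (auto simp: \<A>_def)
  have M_add: "u + v \<in> M" if "u \<in> M" "v \<in> M" for u v
    using M(1) that by (auto simp: K_subspace_def)
  have M_scale: "k *\<^sub>R v \<in> M" if "k \<in> K" "v \<in> M" for k v
    using M(1) that by (auto simp: K_subspace_def)
  have ex: "\<exists>k\<in>K. u - k *\<^sub>R w \<in> M" if u: "u \<in> W" for u
  proof (cases "u \<in> M")
    case True
    then show ?thesis
      using K'(1) by (intro bexI[of _ 0]) auto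
  next
    case False
    \<comment> \<open>Adjoining \<open>u\<close> to \<open>M\<close> gives a strictly larger
      \<open>K\<close>-subspace, which by maximality contains \<open>w\<close>. In the resulting
      equation the coefficient of \<open>u\<close> is nonzero because \<open>w\<close> is not in
      \<open>M\<close>, so the equation can be solved for \<open>u\<close>.\<close>
    define X where "X = {m + k *\<^sub>R u | m k. m \<in> M \<and> k \<in> K}"
    have "K_subspace K X"
      unfolding K_subspace_def
    proof (intro conjI ballI)
      show "0 \<in> X"
        using M(1) K'(1) unfolding X_def K_subspace_def by force
      show "k *\<^sub>R v \<in> X" if "k \<in> K" "v \<in> X" for k v
        using that M_scale K'(4) unfolding X_def by (force simp: scaleR_right_distrib)
      show "a + b \<in> X" if ab: "a \<in> X" "b \<in> X" for a b
      proof -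
        obtain m k m' k' where "a = m + k *\<^sub>R u" "b = m' + k' *\<^sub>R u" "m \<in> M" "k \<in> K" "m' \<in> M" "k' \<in> K"
          using ab unfolding X_def by blast
        then have "a + b = (m + m') + (k + k') *\<^sub>R u" "m + m' \<in> M" "k + k' \<in> K"
          using M_add K'(3) by (auto simp: scaleR_left_distrib)
        then show ?thesis
          unfolding X_def by blast
      qed
    qed
    moreover have "M \<subseteq> X"
    proof
      fix m assume "m \<in> M"
      then have "m = m + 0 *\<^sub>R u \<and> m \<in> M \<and> 0 \<in> K"
        using K'(1) by simp
      then show "m \<in> X"
        unfolding X_def by blast
    qed
    moreover have "u \<in> X"
    proof -
      have "u = 0 + 1 *\<^sub>R u \<and> 0 \<in> M \<and> 1 \<in> K"
        using K'(2) M(1) by (simp add: K_subspace_def)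
      then show ?thesis
        unfolding X_def by blast
    qed
    moreover have "X \<subseteq> W"
      using M(3) W u unfolding X_def K_subspace_def by blast
    ultimately have "w \<in> X"
      using max[of X] M(2) False by (auto simp: \<A>_def)
    then obtain m k where mk: "w = m + k *\<^sub>R u" "m \<in> M" "k \<in> K"
      unfolding X_def by blast
    then have "k \<noteq> 0"
      using M(4) by auto
    have "u - inverse k *\<^sub>R w = (- inverse k) *\<^sub>R m"
      using \<open>k \<noteq> 0\<close> by (simp add: mk(1) scaleR_right_distrib)
    then show ?thesis
      using K'(5,6) mk M_scale by metis
  qed
  \<comment> \<open>This is the coordinate along \<open>w\<close> modulo \<open>M\<close>. It is
    unique: two different values would put a nonzero \<open>K\<close>-multiple of \<open>w\<close>,
    and hence \<open>w\<close> itself, into \<open>M\<close>.\<close>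
  define \<psi> where "\<psi> u = (SOME k. k \<in> K \<and> u - k *\<^sub>R w \<in> M)" for u
  have \<psi>: "\<psi> u \<in> K \<and> u - \<psi> u *\<^sub>R w \<in> M" if "u \<in> W" for u
    unfolding \<psi>_def using ex[OF that] by (intro someI_ex[of "\<lambda>k. k \<in> K \<and> u - k *\<^sub>R w \<in> M"]) (simp add: Bex_def)
  have unique: "\<psi> u = k" if u: "u \<in> W" "k \<in> K" "u - k *\<^sub>R w \<in> M" for u k
  proof (rule ccontr)
    assume ne: "\<psi> u \<noteq> k"
    have "(u - k *\<^sub>R w) + (- 1) *\<^sub>R (u - \<psi> u *\<^sub>R w) \<in> M"
      using \<psi>[OF u(1)] u(3) K'(2,5) M_add M_scale by blast
    then have "(\<psi> u - k) *\<^sub>R w \<in> M"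
      by (simp add: algebra_simps)
    moreover have "inverse (\<psi> u - k) \<in> K"
      using K'(3)[of "\<psi> u" "- k"] K'(5,6) \<psi>[OF u(1)] u(2) by simp
    ultimately have "inverse (\<psi> u - k) *\<^sub>R (\<psi> u - k) *\<^sub>R w \<in> M"
      using M_scale by blast
    then show False
      using ne M(4) by simp
  qed
  have W_add: "u + v \<in> W" if "u \<in> W" "v \<in> W" for u v
    using W that by (auto simp: K_subspace_def)
  have W_scale: "k *\<^sub>R v \<in> W" if "k \<in> K" "v \<in> W" for k v
    using W that by (auto simp: K_subspace_def)
  show thesis
  proof
    fix u v assume uv: "u \<in> W" "v \<in> W"
    have "(u + v) - (\<psi> u + \<psi> v) *\<^sub>R w = (u - \<psi> u *\<^sub>R w) + (v - \<psi> v *\<^sub>R w)"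
      by (simp add: algebra_simps)
    also have "\<dots> \<in> M"
      using M_add \<psi>[OF uv(1)] \<psi>[OF uv(2)] by blast
    finally show "\<psi> (u + v) = \<psi> u + \<psi> v"
      using unique[OF W_add[OF uv] K'(3)] \<psi>[OF uv(1)] \<psi>[OF uv(2)] by blast
  next
    fix k v assume kv: "k \<in> K" "v \<in> W"
    have "k *\<^sub>R v - (k * \<psi> v) *\<^sub>R w = k *\<^sub>R (v - \<psi> v *\<^sub>R w)"
      by (simp add: algebra_simps)
    also have "\<dots> \<in> M"
      using M_scale \<psi>[OF kv(2)] kv(1) by blast
    finally show "\<psi> (k *\<^sub>R v) = k * \<psi> v"
      using unique[OF W_scale[OF kv] K'(4)] \<psi>[OF kv(2)] kv(1) by blast
  next
    fix v assume "v \<in> M0"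
    then show "\<psi> v = 0"
      using M(2,3) K'(1) by (intro unique) auto
  next
    show "\<psi> w = 1"
      using w(1) K'(2) M(1) by (intro unique) (auto simp: K_subspace_def)
  qed
qed

text \<open>Suppose \<open>w\<close> is outside the \<open>K\<close>-span \<open>M0\<close> of
  \<open>B\<close>. Then some \<open>K\<close>-linear \<psi> vanishes on \<open>M0\<close> and is 1
  at \<open>w\<close>. The formal sum \<open>c\<close> of (1, w) minus all (r b, b) evaluates to 0,
  so it is generated by tensor relations; but the test map of \<psi> takes the value 1 on it. So
  \<open>w\<close> has coefficients in \<open>K\<close>, and real independence of \<open>B\<close>
  identifies them with the given ones.\<close>

lemma K_structure_coefficients:
  fixes W :: "'a::real_vector set"
  assumes K: "is_subfield K" and str: "K_structure K W"
    and B: "finite B" "B \<subseteq> W" "independent B"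
    and w: "(\<Sum>b\<in>B. r b *\<^sub>R b) \<in> W" and b: "b \<in> B"
  shows "r b \<in> K"
proof -
  define w where "w = (\<Sum>b\<in>B. r b *\<^sub>R b)"
  define M0 where "M0 = {\<Sum>b\<in>B. k b *\<^sub>R b | k. k ` B \<subseteq> K}"
  have K': "0 \<in> K" "1 \<in> K" "\<And>x y. x \<in> K \<Longrightarrow> y \<in> K \<Longrightarrow> x + y \<in> K" "\<And>x y. x \<in> K \<Longrightarrow> y \<in> K \<Longrightarrow> x * y \<in> K"
    using K unfolding is_subfield_def by auto
  have KW: "K_subspace K W"
    using str by (simp add: K_structure_def)
  have M0: "K_subspace K M0"
    unfolding K_subspace_def
  proof (intro conjI ballI)
    have "0 = (\<Sum>b\<in>B. 0 *\<^sub>R b) \<and> (\<lambda>_. 0) ` B \<subseteq> K"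
      using K'(1) by auto
    then show "0 \<in> M0"
      unfolding M0_def by (intro CollectI exI[of _ "\<lambda>_. 0"])
  next
    fix u v assume "u \<in> M0" "v \<in> M0"
    then obtain k l where "u = (\<Sum>b\<in>B. k b *\<^sub>R b)" "k ` B \<subseteq> K" "v = (\<Sum>b\<in>B. l b *\<^sub>R b)" "l ` B \<subseteq> K"
      unfolding M0_def by blast
    then have "u + v = (\<Sum>b\<in>B. (k b + l b) *\<^sub>R b) \<and> (\<lambda>b. k b + l b) ` B \<subseteq> K"
      using K'(3) by (auto simp: scaleR_left_distrib sum.distrib)
    then show "u + v \<in> M0"
      unfolding M0_def by (intro CollectI exI[of _ "\<lambda>b. k b + l b"])
  next
    fix x v assume x: "x \<in> K" "v \<in> M0"
    then obtain k where "v = (\<Sum>b\<in>B. k b *\<^sub>R b)" "k ` B \<subseteq> K"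
      unfolding M0_def by blast
    then have "x *\<^sub>R v = (\<Sum>b\<in>B. (x * k b) *\<^sub>R b) \<and> (\<lambda>b. x * k b) ` B \<subseteq> K"
      using x(1) K'(4) by (auto simp: scaleR_sum_right)
    then show "x *\<^sub>R v \<in> M0"
      unfolding M0_def by (intro CollectI exI[of _ "\<lambda>b. x * k b"])
  qed
  have "M0 \<subseteq> W"
  proof
    fix v assume "v \<in> M0"
    then obtain k where v: "v = (\<Sum>b\<in>B. k b *\<^sub>R b)" and k: "k ` B \<subseteq> K"
      unfolding M0_def by blast
    have "(\<Sum>b\<in>A. k b *\<^sub>R b) \<in> W" if "A \<subseteq> B" for A
      using finite_subset[OF that B(1)] that
    proof (induction A rule: finite_induct)
      case (insert a A)
      have "k a *\<^sub>R a \<in> W"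
        using KW B(2) k insert.prems unfolding K_subspace_def by blast
      then show ?case
        using KW insert unfolding K_subspace_def by simp
    qed (use KW in \<open>simp add: K_subspace_def\<close>)
    then show "v \<in> W"
      using v by blast
  qed
  have B_M0: "a \<in> M0" if a: "a \<in> B" for a
  proof -
    have "a = (\<Sum>b\<in>B. (if b = a then 1 else 0) *\<^sub>R b) \<and> (\<lambda>b. if b = a then 1 else 0) ` B \<subseteq> K"
      using a K'(1,2) B(1) by (auto simp: if_distrib[of "\<lambda>x. x *\<^sub>R _"] cong: if_cong)
    then show ?thesis
      unfolding M0_def by (intro CollectI exI[of _ "\<lambda>b. if b = a then 1 else 0"])
  qed
  have "w \<in> M0"
  proof (rule ccontr)
    assume "w \<notin> M0"
    then obtain \<psi> :: "'a \<Rightarrow> real" where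
      \<psi>: "\<And>u v. u \<in> W \<Longrightarrow> v \<in> W \<Longrightarrow> \<psi> (u + v) = \<psi> u + \<psi> v"
        "\<And>k v. k \<in> K \<Longrightarrow> v \<in> W \<Longrightarrow> \<psi> (k *\<^sub>R v) = k * \<psi> v"
        "\<And>v. v \<in> M0 \<Longrightarrow> \<psi> v = 0" "\<psi> w = 1"
      using exists_K_functional[OF K KW M0 \<open>M0 \<subseteq> W\<close> w[folded w_def]] by blast
    define c where "c = frag_of (1, w) - (\<Sum>b\<in>B. frag_of (r b, b))"
    have "Poly_Mapping.keys c \<subseteq> UNIV \<times> W"
    proof -
      have "Poly_Mapping.keys (\<Sum>b\<in>B. frag_of (r b, b)) \<subseteq> UNIV \<times> W"
        using keys_sum[of "\<lambda>b. frag_of (r b, b)" B] B(2) by auto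
      then show ?thesis
        using keys_diff[of "frag_of (1, w)" "\<Sum>b\<in>B. frag_of (r b, b)"] w unfolding c_def w_def by auto
    qed
    moreover have "tensor_eval c = 0"
      by (simp add: c_def tensor_eval_eq_frag_eval frag_eval_diff frag_eval_sum w_def)
    ultimately have "c \<in> generate (free_Abelian_group (UNIV \<times> W)) (tensor_relations K W)"
      using tensor_eval_kernel[OF str] by blast
    moreover have "balanced K W (\<lambda>p. fst p * \<psi> (snd p))"
      using \<psi>(1,2) by (auto simp: balanced_def algebra_simps)
    ultimately have "frag_eval (\<lambda>p. fst p * \<psi> (snd p)) c = 0"
      using frag_eval_generate_relations[OF KW] by blast
    moreover have "frag_eval (\<lambda>p. fst p * \<psi> (snd p)) c = 1"
      using \<psi>(3,4) B_M0 by (simp add: c_def frag_eval_diff frag_eval_sum)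
    ultimately show False
      by simp
  qed
  then obtain k where k: "w = (\<Sum>b\<in>B. k b *\<^sub>R b)" "k ` B \<subseteq> K"
    unfolding M0_def by blast
  have "(\<Sum>b\<in>B. (r b - k b) *\<^sub>R b) = 0"
    using k(1) unfolding w_def by (simp add: scaleR_left_diff_distrib sum_subtractf)
  then have "r b - k b = 0"
    using independentD[OF B(3,1) subset_refl, of "\<lambda>b. r b - k b"] b by blast
  then show ?thesis
    using k(2) b by auto
qed

subsection \<open>Rational functionals and polycones\<close>

text \<open>This collects what the rest of the proof takes from the \<open>K\<close>-structure:
  \<open>span_W\<close> comes from surjectivity of the canonical map and \<open>coefficients\<close>
  from injectivity. Tensor products do not occur inside the locale.\<close>

locale rational_structure =
  fixes K :: "real set" and W :: "'a::real_vector set"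
  assumes K: "is_subfield K" and W: "K_subspace K W" and span_W: "span W = UNIV"
    and finite_span: "\<exists>B::'a set. finite B \<and> span B = UNIV"
    and coefficients: "\<And>B r b. finite B \<Longrightarrow> B \<subseteq> W \<Longrightarrow> independent B \<Longrightarrow>
      (\<Sum>b\<in>B. r b *\<^sub>R b) \<in> W \<Longrightarrow> b \<in> B \<Longrightarrow> r b \<in> K"
begin

section \<open>Rational bases and rational functionals\<close>

lemma K_mult: "x \<in> K \<Longrightarrow> y \<in> K \<Longrightarrow> x * y \<in> K"
  and K_minus: "x \<in> K \<Longrightarrow> - x \<in> K" and K_inverse: "x \<in> K \<Longrightarrow> inverse x \<in> K"
  using K by (auto simp: is_subfield_def)

lemma W_add: "v \<in> W \<Longrightarrow> w \<in> W \<Longrightarrow> v + w \<in> W"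
  and W_scale: "k \<in> K \<Longrightarrow> w \<in> W \<Longrightarrow> k *\<^sub>R w \<in> W"
  using W by (auto simp: K_subspace_def)

lemma W_diff_scale: "v \<in> W \<Longrightarrow> w \<in> W \<Longrightarrow> k \<in> K \<Longrightarrow> v - k *\<^sub>R w \<in> W"
  using W_add[of v "(- k) *\<^sub>R w"] W_scale[of "- k" w] by (simp add: K_minus)

lemma independent_finite:
  assumes "independent B"
  shows "finite (B::'a set)"
  using finite_span real_vector.independent_span_bound[OF _ assms] by (metis subset_UNIV)

lemma rational_basis_extend:
  assumes "A \<subseteq> W" "independent A"
  obtains B where "A \<subseteq> B" "B \<subseteq> W" "independent B" "span B = UNIV"
proof -
  obtain B where B: "A \<subseteq> B" "B \<subseteq> W" "independent B" "W \<subseteq> span B"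
    using real_vector.maximal_independent_subset_extend[OF assms] by blast
  have "span W \<subseteq> span B"
    using span_minimal[OF B(4) subspace_span] .
  then show thesis
    using that B span_W by auto
qed

definition rational_functional :: "('a \<Rightarrow> real) \<Rightarrow> bool" where
  "rational_functional f \<longleftrightarrow> linear f \<and> f ` W \<subseteq> K"

lemma rational_functional_minus: "rational_functional f \<Longrightarrow> rational_functional (\<lambda>x. - f x)"
  by (auto simp: rational_functional_def K_minus intro: linear_compose_neg)

text \<open>The coordinate functionals of a basis taken from \<open>W\<close> are
  \<open>K\<close>-valued on \<open>W\<close>; this is precisely what \<open>coefficients\<close>
  provides.\<close>

lemma dual_basis:
  assumes B: "B \<subseteq> W" "independent B" "span B = UNIV"
  obtains g where "\<forall>b\<in>B. rational_functional (g b)" and "\<forall>x. x = (\<Sum>b\<in>B. g b x *\<^sub>R b)"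
    and "\<forall>b\<in>B. \<forall>c\<in>B. g b c = (if c = b then 1 else 0)"
proof -
  have fin: "finite B"
    using independent_finite[OF B(2)] .
  have "\<exists>g. linear g \<and> (\<forall>c\<in>B. g c = (if c = b then 1 else (0::real)))" for b
    using linear_independent_extend[OF B(2), of "\<lambda>c. if c = b then 1 else 0"] .
  then obtain g :: "'a \<Rightarrow> 'a \<Rightarrow> real"
    where g: "\<And>b. linear (g b)" "\<And>b c. c \<in> B \<Longrightarrow> g b c = (if c = b then 1 else 0)"
    by metis
  have *: "g b (\<Sum>c\<in>B. r c *\<^sub>R c) = r b" if "b \<in> B" for b r
  proof -
    have "g b (\<Sum>c\<in>B. r c *\<^sub>R c) = (\<Sum>c\<in>B. r c * g b c)"
      by (simp add: linear_sum[OF g(1)] linear_scale[OF g(1)])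
    also have "\<dots> = (\<Sum>c\<in>B. if c = b then r c else 0)"
      by (intro sum.cong) (auto simp: g(2))
    also have "\<dots> = r b"
      using that fin by simp
    finally show ?thesis .
  qed
  have ex: "\<exists>r. x = (\<Sum>b\<in>B. r b *\<^sub>R b)" for x
    using B(3) span_finite[OF fin] by blast
  have expand: "x = (\<Sum>b\<in>B. g b x *\<^sub>R b)" for x
  proof -
    obtain r where r: "x = (\<Sum>b\<in>B. r b *\<^sub>R b)"
      using ex by blast
    also have "\<dots> = (\<Sum>b\<in>B. g b x *\<^sub>R b)"
      using * by (intro sum.cong) (simp_all add: r)
    finally show ?thesis .
  qed
  have "g b w \<in> K" if "b \<in> B" "w \<in> W" for b w
    using coefficients[OF fin B(1,2) _ that(1), of "\<lambda>b. g b w"] expand[of w] that(2) by simp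
  then have "\<forall>b\<in>B. rational_functional (g b)"
    using g(1) by (auto simp: rational_functional_def)
  moreover have "\<forall>b\<in>B. \<forall>c\<in>B. g b c = (if c = b then 1 else 0)"
    using g(2) by blast
  ultimately show thesis
    using that expand by metis
qed

lemma rational_functional_exists:
  assumes "A \<subseteq> W" "independent A" "a \<in> A"
  obtains g where "rational_functional g" "g a = 1" "\<And>b. b \<in> A \<Longrightarrow> b \<noteq> a \<Longrightarrow> g b = 0"
proof -
  obtain B where B: "A \<subseteq> B" "B \<subseteq> W" "independent B" "span B = UNIV"
    using rational_basis_extend[OF assms(1,2)] .
  obtain g where g: "\<forall>b\<in>B. rational_functional (g b)" "\<forall>x. x = (\<Sum>b\<in>B. g b x *\<^sub>R b)"
    "\<forall>b\<in>B. \<forall>c\<in>B. g b c = (if c = b then 1 else 0)"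
    using dual_basis[OF B(2-4)] .
  have "rational_functional (g a)" "g a a = 1" "\<And>b. b \<in> A \<Longrightarrow> b \<noteq> a \<Longrightarrow> g a b = 0"
    using g(1,3) subsetD[OF B(1)] assms(3) by auto
  then show thesis
    by (rule that)
qed

text \<open>This is Gaussian elimination over \<open>K\<close>. If \<open>f\<close> is nonzero at
  some \<open>u\<close> in \<open>W\<close> annihilated by the earlier functionals, the projection
  \<open>p\<close> along \<open>u\<close> onto the kernel of \<open>f\<close> has its factor
  \<open>f x / f u\<close> in \<open>K\<close> for \<open>x\<close> in \<open>W\<close>. So it
  preserves \<open>W\<close> and the earlier equations, and carries a rational spanning set for
  \<open>F\<close> to one for \<open>insert f F\<close>.\<close>

lemma zeros_rational:
  assumes "finite F" "\<And>f. f \<in> F \<Longrightarrow> rational_functional f"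
  shows "{x. \<forall>f\<in>F. f x = 0} \<subseteq> span {w\<in>W. \<forall>f\<in>F. f w = 0}"
  using assms
proof (induction F rule: finite_induct)
  case empty
  then show ?case
    using span_W by simp
next
  case (insert f F)
  let ?U = "{w\<in>W. \<forall>g\<in>F. g w = 0}"
  have f: "linear f" "f ` W \<subseteq> K"
    using insert.prems by (auto simp: rational_functional_def)
  have F: "linear g" if "g \<in> F" for g
    using insert.prems that by (auto simp: rational_functional_def)
  have IH: "{x. \<forall>g\<in>F. g x = 0} \<subseteq> span ?U"
    using insert by blast
  show ?case
  proof (cases "\<exists>w\<in>?U. f w \<noteq> 0")
    case False
    then have "?U = {w\<in>W. \<forall>g\<in>insert f F. g w = 0}"
      by auto
    then show ?thesis
      using IH by auto
  next
    case True
    then obtain u where u: "u \<in> ?U" "f u \<noteq> 0"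
      by blast
    define p where "p x = x - (f x / f u) *\<^sub>R u" for x
    have p: "linear p"
      unfolding p_def using f(1)
      by (intro linearI) (simp_all add: linear_add linear_scale algebra_simps add_divide_distrib)
    have "p ` ?U \<subseteq> {w\<in>W. \<forall>g\<in>insert f F. g w = 0}"
    proof
      fix y assume "y \<in> p ` ?U"
      then obtain x where x: "x \<in> ?U" "y = p x"
        by blast
      have "f x / f u \<in> K"
        using x u f(2) by (auto simp: divide_inverse intro!: K_mult K_inverse)
      then have "y \<in> W"
        using x u by (auto simp: p_def intro: W_diff_scale)
      moreover have "f y = 0"
        using u(2) by (simp add: x p_def linear_diff[OF f(1)] linear_scale[OF f(1)])
      moreover have "g y = 0" if "g \<in> F" for g
      proof -
        have "g x = 0" "g u = 0"
          using x(1) u(1) that by auto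
        then show ?thesis
          by (simp add: x(2) p_def linear_diff[OF F[OF that]] linear_scale[OF F[OF that]])
      qed
      ultimately show "y \<in> {w\<in>W. \<forall>g\<in>insert f F. g w = 0}"
        by auto
    qed
    then have "p ` span ?U \<subseteq> span {w\<in>W. \<forall>g\<in>insert f F. g w = 0}"
      unfolding linear_span_image[OF p, symmetric] by (rule span_mono)
    \<comment> \<open>The projection fixes every zero of \<open>f\<close>, so nothing is lost by
      applying it.\<close>
    moreover have "x \<in> p ` span ?U" if "x \<in> {x. \<forall>g\<in>insert f F. g x = 0}" for x
    proof
      show "x = p x" "x \<in> span ?U"
        using that IH by (auto simp: p_def)
    qed
    ultimately show ?thesis
      by blast
  qed
qed

section \<open>Halfspaces and polycones as inequalities\<close>

lemma rational_subspaceI: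
  assumes "subspace U" "U \<subseteq> span (U \<inter> W)"
  shows "rational_subspace W U"
proof -
  obtain B where B: "B \<subseteq> U \<inter> W" "independent B" "U \<inter> W \<subseteq> span B"
    using real_vector.maximal_independent_subset by blast
  have "U \<subseteq> span B"
    using assms(2) span_minimal[OF B(3) subspace_span] by blast
  moreover have "span B \<subseteq> U"
    using B(1) assms(1) by (intro span_minimal) auto
  ultimately show ?thesis
    using B unfolding rational_subspace_def by blast
qed

text \<open>A rational basis of the hyperplane together with some \<open>u\<close> in
  \<open>W\<close> off the hyperplane is a rational basis of the whole space, and
  \<open>f w / f u\<close> is the coordinate of \<open>w\<close> at \<open>u\<close>. Hence a
  rational hyperplane has an equation with values in \<open>K\<close> on \<open>W\<close>, obtained
  by rescaling. The converse is elimination for a single functional.\<close>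

lemma rational_halfspace_iff:
  "rational_halfspace W h \<longleftrightarrow>
     (\<exists>f. rational_functional f \<and> (\<exists>x. f x \<noteq> 0) \<and> h = {x. 0 \<le> f x})"
proof
  assume "rational_halfspace W h"
  then obtain f :: "'a \<Rightarrow> real" where "linear f \<and> (\<exists>x. f x \<noteq> 0) \<and> rational_subspace W {x. f x = 0} \<and> h = {x. f x \<ge> 0}"
    unfolding rational_halfspace_def ..
  then have f: "linear f" "\<exists>x. f x \<noteq> 0" "h = {x. f x \<ge> 0}" "rational_subspace W {x. f x = 0}"
    by simp_all
  then obtain B where B: "B \<subseteq> W" "independent B" "span B = {x. f x = 0}"
    unfolding rational_subspace_def by blast
  have "\<exists>u\<in>W. f u \<noteq> 0"
    using f(2) linear_eq_0_on_span[OF f(1), of W] span_W by auto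
  then obtain u where u: "u \<in> W" "f u \<noteq> 0"
    by blast
  have uB: "u \<notin> span B"
    using u(2) B(3) by simp
  have ind: "independent (insert u B)"
    using uB B(2) by (rule independent_insertI)
  have fin: "finite B" "u \<notin> B"
    using independent_finite[OF B(2)] uB span_base by auto
  have quot: "f w / f u \<in> K" if w: "w \<in> W" for w
  proof -
    have "w - (f w / f u) *\<^sub>R u \<in> span B"
      using u(2) by (simp add: B(3) linear_diff[OF f(1)] linear_scale[OF f(1)])
    then obtain r where r: "w - (f w / f u) *\<^sub>R u = (\<Sum>b\<in>B. r b *\<^sub>R b)"
      using span_finite[OF fin(1)] by blast
    define r' where "r' = r(u := f w / f u)"
    have "(\<Sum>b\<in>B. r' b *\<^sub>R b) = (\<Sum>b\<in>B. r b *\<^sub>R b)"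
      using fin by (intro sum.cong) (auto simp: r'_def)
    then have "w = (\<Sum>b\<in>insert u B. r' b *\<^sub>R b)"
      using fin r by (simp add: r'_def algebra_simps)
    then have "r' u \<in> K"
      using coefficients[of "insert u B" r' u] fin B(1) u(1) ind w by simp
    then show ?thesis
      by (simp add: r'_def)
  qed
  \<comment> \<open>The absolute value keeps the inequality pointing the same way, at the price of a
    sign that \<open>K\<close> absorbs.\<close>
  define f' where "f' x = f x / \<bar>f u\<bar>" for x
  have "f' w \<in> K" if "w \<in> W" for w
  proof (cases "f u > 0")
    case True
    then show ?thesis
      using quot[OF that] by (simp add: f'_def)
  next
    case False
    then show ?thesis
      using K_minus[OF quot[OF that]] by (simp add: f'_def)
  qed
  moreover have "linear f'"
    using f(1) unfolding f'_def
    by (intro linearI) (simp_all add: linear_add linear_scale add_divide_distrib)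
  moreover have "h = {x. 0 \<le> f' x}" "\<exists>x. f' x \<noteq> 0"
    using f(2,3) u(2) by (auto simp: f'_def zero_le_divide_iff)
  ultimately show "\<exists>f. rational_functional f \<and> (\<exists>x. f x \<noteq> 0) \<and> h = {x. 0 \<le> f x}"
    unfolding rational_functional_def by blast
next
  assume "\<exists>f. rational_functional f \<and> (\<exists>x. f x \<noteq> 0) \<and> h = {x. 0 \<le> f x}"
  then obtain f where f: "rational_functional f" "\<exists>x. f x \<noteq> 0" "h = {x. 0 \<le> f x}"
    by blast
  have lin: "linear f"
    using f(1) by (simp add: rational_functional_def)
  have "{x. f x = 0} \<subseteq> span ({x. f x = 0} \<inter> W)"
    using zeros_rational[of "{f}"] f(1) by (simp add: Int_def conj_commute)
  then have "rational_subspace W {x. f x = 0}"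
    by (intro rational_subspaceI linear_subspace_kernel lin)
  then show "rational_halfspace W h"
    unfolding rational_halfspace_def using lin f(2,3) by blast
qed

lemma polycone_iff:
  "polycone W \<sigma> \<longleftrightarrow>
     (\<exists>F. finite F \<and> (\<forall>f\<in>F. rational_functional f) \<and> \<sigma> = {x. \<forall>f\<in>F. 0 \<le> f x})"
proof
  assume "polycone W \<sigma>"
  then obtain H where H: "finite H" "\<forall>h\<in>H. rational_halfspace W h" "\<sigma> = \<Inter>H"
    unfolding polycone_def by blast
  then obtain f where f: "\<And>h. h \<in> H \<Longrightarrow> rational_functional (f h) \<and> h = {x. 0 \<le> f h x}"
    unfolding rational_halfspace_iff by metis
  have "\<sigma> = {x. \<forall>g\<in>f ` H. 0 \<le> g x}"
    using f H(3) by blast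
  then show "\<exists>F. finite F \<and> (\<forall>f\<in>F. rational_functional f) \<and> \<sigma> = {x. \<forall>f\<in>F. 0 \<le> f x}"
    using f H(1) by (intro exI[of _ "f ` H"]) auto
next
  assume "\<exists>F. finite F \<and> (\<forall>f\<in>F. rational_functional f) \<and> \<sigma> = {x. \<forall>f\<in>F. 0 \<le> f x}"
  then obtain F where F: "finite F" "\<forall>f\<in>F. rational_functional f" "\<sigma> = {x. \<forall>f\<in>F. 0 \<le> f x}"
    by blast
  \<comment> \<open>A functional that is identically zero bounds no halfspace, and its inequality
    holds everywhere, so it is dropped.\<close>
  define H where "H = (\<lambda>f. {x. 0 \<le> f x}) ` {f\<in>F. \<exists>x. f x \<noteq> 0}"
  have "finite H" "\<forall>h\<in>H. rational_halfspace W h"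
    using F(1,2) by (auto simp: H_def rational_halfspace_iff)
  moreover have "\<sigma> = \<Inter>H"
  proof -
    have "(\<forall>f\<in>F. 0 \<le> f x) \<longleftrightarrow> (\<forall>f\<in>{f\<in>F. \<exists>x. f x \<noteq> 0}. 0 \<le> f x)" for x
    proof (intro iffI ballI)
      fix f assume *: "\<forall>f\<in>{f\<in>F. \<exists>x. f x \<noteq> 0}. 0 \<le> f x" and "f \<in> F"
      then show "0 \<le> f x"
        by (cases "f x = 0") auto
    qed simp
    then have "F' = {x. \<forall>f\<in>{f\<in>F. \<exists>x. f x \<noteq> 0}. 0 \<le> f x}" if "F' = {x. \<forall>f\<in>F. 0 \<le> f x}" for F'
      by (simp only: that)
    from this[OF F(3)] show ?thesis
      by (auto simp: H_def)
  qed
  ultimately show "polycone W \<sigma>"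
    unfolding polycone_def by blast
qed

section \<open>Closure properties of polycones\<close>

lemma polycone_convex_cone:
  assumes "polycone W \<sigma>"
  shows "convex_cone \<sigma>"
proof -
  obtain F where F: "\<forall>f\<in>F. rational_functional f" "\<sigma> = {x. \<forall>f\<in>F. 0 \<le> f x}"
    using assms unfolding polycone_iff by blast
  then have "linear f" if "f \<in> F" for f
    using that by (auto simp: rational_functional_def)
  then show ?thesis
    unfolding convex_cone_iff F(2) by (auto simp: linear_0 linear_add linear_scale)
qed

lemma polycone_0: "polycone W \<sigma> \<Longrightarrow> 0 \<in> \<sigma>"
  using polycone_convex_cone by (simp add: convex_cone_iff)

lemma polycone_Int:
  assumes "polycone W \<sigma>" "polycone W \<tau>"
  shows "polycone W (\<sigma> \<inter> \<tau>)"
proof -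
  obtain F G where F: "finite F" "\<forall>f\<in>F. rational_functional f" "\<sigma> = {x. \<forall>f\<in>F. 0 \<le> f x}"
    and G: "finite G" "\<forall>f\<in>G. rational_functional f" "\<tau> = {x. \<forall>f\<in>G. 0 \<le> f x}"
    using assms unfolding polycone_iff by blast
  show ?thesis
    unfolding polycone_iff using F G by (intro exI[of _ "F \<union> G"]) auto
qed

lemma polycone_zeros:
  assumes "finite F" "\<And>f. f \<in> F \<Longrightarrow> rational_functional f"
  shows "polycone W {x. \<forall>f\<in>F. f x = 0}"
proof -
  have "(\<forall>f\<in>F. f x = 0) \<longleftrightarrow> (\<forall>f\<in>F \<union> (\<lambda>f x. - f x) ` F. 0 \<le> f x)" for x
    by (simp add: ball_Un) (metis order_antisym order_refl)
  then show ?thesis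
    unfolding polycone_iff using assms rational_functional_minus
    by (intro exI[of _ "F \<union> (\<lambda>f x. - f x) ` F"]) auto
qed

text \<open>Extend \<open>v\<close> to a rational basis; its line is cut out by the coordinates of
  the other basis vectors.\<close>

lemma polycone_span_singleton:
  assumes "v \<in> W" "v \<noteq> 0"
  shows "polycone W (span {v})"
proof -
  obtain B where B: "{v} \<subseteq> B" "B \<subseteq> W" "independent B" "span B = UNIV"
    using rational_basis_extend[of "{v}"] assms by auto
  obtain g where g: "\<forall>b\<in>B. rational_functional (g b)" "\<forall>x. x = (\<Sum>b\<in>B. g b x *\<^sub>R b)"
    "\<forall>b\<in>B. \<forall>c\<in>B. g b c = (if c = b then 1 else 0)"
    using dual_basis[OF B(2-4)] .
  have fin: "finite B"
    using independent_finite[OF B(3)] .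
  have "x \<in> span {v} \<longleftrightarrow> (\<forall>f\<in>g ` (B - {v}). f x = 0)" for x
  proof
    assume "x \<in> span {v}"
    then obtain k where "x = k *\<^sub>R v"
      by (auto simp: span_singleton)
    then show "\<forall>f\<in>g ` (B - {v}). f x = 0"
      using B(1) g(1,3) by (auto simp: rational_functional_def linear_scale)
  next
    assume *: "\<forall>f\<in>g ` (B - {v}). f x = 0"
    have "x = (\<Sum>b\<in>B. g b x *\<^sub>R b)"
      using g(2) by (rule spec)
    also have "\<dots> = g v x *\<^sub>R v + (\<Sum>b\<in>B - {v}. g b x *\<^sub>R b)"
      using B(1) fin by (intro sum.remove) auto
    also have "\<dots> = g v x *\<^sub>R v"
      using * by simp
    finally have "x = g v x *\<^sub>R v" .
    then show "x \<in> span {v}"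
      by (metis span_base span_scale singletonI)
  qed
  then have "span {v} = {x. \<forall>f\<in>g ` (B - {v}). f x = 0}"
    by blast
  then show ?thesis
    using polycone_zeros[of "g ` (B - {v})"] g(1) fin by auto
qed

text \<open>The inequalities of the image are the old ones composed with the inverse
  \<open>S\<close>, so it is \<open>S\<close> that has to preserve \<open>W\<close>.\<close>

lemma polycone_image:
  assumes S: "linear S" "S ` W \<subseteq> W" "\<And>x. S (T x) = x" "\<And>x. T (S x) = x" and "polycone W \<sigma>"
  shows "polycone W (T ` \<sigma>)"
proof -
  obtain F where F: "finite F" "\<forall>f\<in>F. rational_functional f" "\<sigma> = {x. \<forall>f\<in>F. 0 \<le> f x}"
    using assms unfolding polycone_iff by blast
  have "rational_functional (f \<circ> S)" if "f \<in> F" for f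
    using F(2) S(1,2) that by (force simp: rational_functional_def intro: linear_compose)
  moreover have "y \<in> T ` \<sigma> \<longleftrightarrow> S y \<in> \<sigma>" for y
    using S(3,4) by (metis image_iff)
  ultimately show ?thesis
    unfolding polycone_iff using F(1,3) by (intro exI[of _ "(\<lambda>f. f \<circ> S) ` F"]) auto
qed

section \<open>Relative interiors, faces and rational spans\<close>

lemma cone_interior_point:
  assumes "convex_cone C" "finite F" "\<And>f. f \<in> F \<Longrightarrow> linear f" "\<And>f x. f \<in> F \<Longrightarrow> x \<in> C \<Longrightarrow> 0 \<le> f x"
  shows "\<exists>z\<in>C. \<forall>f\<in>F. (\<exists>x\<in>C. f x \<noteq> (0::real)) \<longrightarrow> 0 < f z"
  using assms(2-4)
proof (induction F rule: finite_induct)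
  case empty
  then show ?case
    using assms(1) by (auto simp: convex_cone_iff)
next
  case (insert f F)
  then obtain z where z: "z \<in> C" "\<forall>g\<in>F. (\<exists>x\<in>C. g x \<noteq> 0) \<longrightarrow> 0 < g z"
    by blast
  show ?case
  proof (cases "\<exists>x\<in>C. f x \<noteq> 0")
    case False
    then show ?thesis
      using z by blast
  next
    case True
    then obtain x where x: "x \<in> C" "f x \<noteq> 0"
      by blast
    \<comment> \<open>All functionals are nonnegative on \<open>C\<close>, so adding a witness for
      \<open>f\<close> cannot cancel the positivity already achieved for the others.\<close>
    have "0 < f (z + x)"
      using insert.prems(2)[of f x] insert.prems(2)[of f z] x z(1) insert.prems(1)[of f]
      by (simp add: linear_add)
    moreover have "0 < g (z + x)" if "g \<in> F" "\<exists>x\<in>C. g x \<noteq> 0" for g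
      using insert.prems(2)[of g x] insert.prems(1)[of g] x z that
      by (simp add: linear_add add_pos_nonneg)
    ultimately show ?thesis
      using convex_cone_add[OF assms(1) z(1) x(1)] by blast
  qed
qed

lemma small_multiple:
  assumes "finite F" "\<And>f. f \<in> F \<Longrightarrow> 0 < f (z::'b)"
  shows "\<exists>e>0. \<forall>f\<in>F. e * \<bar>f x\<bar> \<le> (f z :: real)"
  using assms
proof (induction F rule: finite_induct)
  case empty
  then show ?case
    by (intro exI[of _ 1]) simp
next
  case (insert f F)
  then obtain e where e: "0 < e" "\<forall>g\<in>F. e * \<bar>g x\<bar> \<le> g z"
    by auto
  \<comment> \<open>The summand 1 keeps the denominator positive when
    \<open>f x = 0\<close>.\<close>
  define d where "d = min e (f z / (\<bar>f x\<bar> + 1))"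
  have "0 < f z"
    using insert.prems by simp
  then have "0 < d"
    using e(1) by (simp add: d_def)
  have "d * \<bar>f x\<bar> \<le> d * (\<bar>f x\<bar> + 1)"
    using \<open>0 < d\<close> by simp
  also have "\<dots> \<le> f z / (\<bar>f x\<bar> + 1) * (\<bar>f x\<bar> + 1)"
    by (intro mult_right_mono) (auto simp: d_def)
  also have "\<dots> = f z"
    by simp
  finally have "d * \<bar>f x\<bar> \<le> f z" .
  moreover have "d * \<bar>g x\<bar> \<le> g z" if "g \<in> F" for g
    using e(2) that mult_right_mono[of d e "\<bar>g x\<bar>"] by (fastforce simp: d_def)
  ultimately show ?case
    using \<open>0 < d\<close> by blast
qed

text \<open>
  For \<open>C\<close> inside a cone \<open>{f \<ge> 0}\<close>, \<open>z\<close> is positive on every \<open>f \<in> F\<close> that does not vanish on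
  \<open>C\<close>, so \<open>z\<close> can be moved in both directions inside the common zeros of the others.
\<close>

lemma cone_relative_interior:
  assumes "convex_cone C" "finite F" "\<And>f. f \<in> F \<Longrightarrow> rational_functional f"
    and "C \<subseteq> {x. \<forall>f\<in>F. 0 \<le> f x}"
  obtains z where "z \<in> C"
    and "\<And>x. \<forall>f\<in>F. (\<forall>y\<in>C. f y = 0) \<longrightarrow> f x = 0 \<Longrightarrow>
           \<exists>e>0. z + e *\<^sub>R x \<in> {x. \<forall>f\<in>F. 0 \<le> f x} \<and> z - e *\<^sub>R x \<in> {x. \<forall>f\<in>F. 0 \<le> f x}"
proof -
  have lin: "linear f" if "f \<in> F" for f
    using assms(3) that by (auto simp: rational_functional_def)
  obtain z where z: "z \<in> C" "\<forall>f\<in>F. (\<exists>x\<in>C. f x \<noteq> 0) \<longrightarrow> 0 < f z"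
    using cone_interior_point[OF assms(1,2) lin] assms(4) by blast
  have "\<exists>e>0. z + e *\<^sub>R x \<in> {x. \<forall>f\<in>F. 0 \<le> f x} \<and> z - e *\<^sub>R x \<in> {x. \<forall>f\<in>F. 0 \<le> f x}"
    if x: "\<forall>f\<in>F. (\<forall>y\<in>C. f y = 0) \<longrightarrow> f x = 0" for x
  proof -
    have "finite {f\<in>F. \<exists>y\<in>C. f y \<noteq> 0}"
      using assms(2) by simp
    then obtain e where e: "0 < e" "\<forall>f\<in>{f\<in>F. \<exists>y\<in>C. f y \<noteq> 0}. e * \<bar>f x\<bar> \<le> f z"
      using small_multiple[of "{f\<in>F. \<exists>y\<in>C. f y \<noteq> 0}" z x] z(2) by auto
    \<comment> \<open>If \<open>f\<close> vanishes on \<open>C\<close>, both sides are 0; otherwise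
      \<open>f\<close> is one of the functionals that determined \<open>e\<close>.\<close>
    have bound: "e * \<bar>f x\<bar> \<le> f z" if "f \<in> F" for f
      using e(2) x z(1) that by (cases "\<forall>y\<in>C. f y = 0") auto
    have "0 \<le> f (z + e *\<^sub>R x) \<and> 0 \<le> f (z - e *\<^sub>R x)" if "f \<in> F" for f
    proof -
      have "\<bar>e * f x\<bar> \<le> f z"
        using bound[OF that] e(1) by (simp add: abs_mult)
      then show ?thesis
        using lin[OF that] by (simp add: linear_add linear_diff linear_scale abs_le_iff)
    qed
    then show ?thesis
      using e(1) by blast
  qed
  then show thesis
    using that z(1) by blast
qed

text \<open>Let \<open>x\<close> be in \<sigma> and annihilated by every defining functional that
  vanishes on \<open>C\<close>. A relative interior point \<open>z\<close> of \<open>C\<close> can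
  be moved by a small -e x without leaving \<sigma>, so \<open>z\<close> is the sum of e x and z - e
  x in \<sigma>, and the face property puts \<open>x\<close> into \<open>C\<close>. Thus
  \<open>C\<close> is \<sigma> cut by finitely many rational hyperplanes. This yields polycones from
  cones for which no inequalities are given.\<close>

lemma polycone_face:
  assumes "polycone W \<sigma>" "convex_cone C" "C \<subseteq> \<sigma>"
    and face: "\<And>a b. a \<in> \<sigma> \<Longrightarrow> b \<in> \<sigma> \<Longrightarrow> a + b \<in> C \<Longrightarrow> a \<in> C"
  shows "polycone W C"
proof -
  obtain F where F: "finite F" "\<forall>f\<in>F. rational_functional f" "\<sigma> = {x. \<forall>f\<in>F. 0 \<le> f x}"
    using assms(1) unfolding polycone_iff by blast
  obtain z where z: "z \<in> C" "\<And>x. \<forall>f\<in>F. (\<forall>y\<in>C. f y = 0) \<longrightarrow> f x = 0 \<Longrightarrow>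
           \<exists>e>0. z + e *\<^sub>R x \<in> \<sigma> \<and> z - e *\<^sub>R x \<in> \<sigma>"
    using cone_relative_interior[OF assms(2) F(1)] F(2,3) assms(3) by blast
  let ?I = "{f\<in>F. \<forall>y\<in>C. f y = 0}"
  have "x \<in> C" if x: "x \<in> \<sigma>" "\<forall>f\<in>?I. f x = 0" for x
  proof -
    obtain e where e: "0 < e" "z - e *\<^sub>R x \<in> \<sigma>"
      using z(2)[of x] x(2) by blast
    have "e *\<^sub>R x \<in> \<sigma>"
      using polycone_convex_cone[OF assms(1)] x(1) e(1) by (simp add: convex_cone_iff)
    then have "e *\<^sub>R x \<in> C"
      using face[of "e *\<^sub>R x" "z - e *\<^sub>R x"] e(2) z(1) by simp
    then show ?thesis
      using convex_cone_scaleR[OF assms(2), of "inverse e" "e *\<^sub>R x"] e(1) by simp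
  qed
  then have "C = \<sigma> \<inter> {x. \<forall>f\<in>?I. f x = 0}"
    using assms(3) by auto
  then show ?thesis
    using polycone_Int[OF assms(1) polycone_zeros[of ?I]] F(1,2) by auto
qed

text \<open>The span is the common zero set of the defining functionals that vanish on \<sigma>: any
  such zero \<open>x\<close> is a multiple of the difference of the points z + e x and z of
  \<sigma>. Common zero sets are spanned rationally by \<open>zeros_rational\<close>.\<close>

lemma polycone_span_rational:
  assumes "polycone W \<sigma>"
  shows "span \<sigma> \<subseteq> span (span \<sigma> \<inter> W)"
proof -
  obtain F where F: "finite F" "\<forall>f\<in>F. rational_functional f" "\<sigma> = {x. \<forall>f\<in>F. 0 \<le> f x}"
    using assms(1) unfolding polycone_iff by blast
  obtain z where z: "z \<in> \<sigma>" "\<And>x. \<forall>f\<in>F. (\<forall>y\<in>\<sigma>. f y = 0) \<longrightarrow> f x = 0 \<Longrightarrow>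
           \<exists>e>0. z + e *\<^sub>R x \<in> \<sigma> \<and> z - e *\<^sub>R x \<in> \<sigma>"
    using cone_relative_interior[OF polycone_convex_cone[OF assms] F(1)] F(2,3) by blast
  let ?I = "{f\<in>F. \<forall>y\<in>\<sigma>. f y = 0}"
  have zeros: "{x. \<forall>f\<in>?I. f x = 0} \<subseteq> span \<sigma>"
  proof
    fix x assume "x \<in> {x. \<forall>f\<in>?I. f x = 0}"
    then obtain e where e: "0 < e" "z + e *\<^sub>R x \<in> \<sigma>"
      using z(2)[of x] by blast
    then have "inverse e *\<^sub>R ((z + e *\<^sub>R x) - z) \<in> span \<sigma>"
      using z(1) by (intro span_scale span_diff span_base)
    then show "x \<in> span \<sigma>"
      using e(1) by simp
  qed
  have "span \<sigma> \<subseteq> {x. \<forall>f\<in>?I. f x = 0}"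
  proof
    fix x assume "x \<in> span \<sigma>"
    then have "f x = 0" if "f \<in> ?I" for f
      using that F(2) linear_eq_0_on_span[of f \<sigma>] by (auto simp: rational_functional_def)
    then show "x \<in> {x. \<forall>f\<in>?I. f x = 0}"
      by blast
  qed
  also have "\<dots> \<subseteq> span {w\<in>W. \<forall>f\<in>?I. f w = 0}"
    using zeros_rational[of ?I] F(1,2) by auto
  also have "\<dots> \<subseteq> span (span \<sigma> \<inter> W)"
    using zeros by (intro span_mono) auto
  finally show ?thesis .
qed

lemma polycone_rational_vector:
  assumes "polycone W \<sigma>" "\<sigma> \<noteq> {0}"
  obtains w where "w \<in> W" "w \<in> span \<sigma>" "w \<noteq> 0"
proof -
  have "\<not> span \<sigma> \<inter> W \<subseteq> {0}"
  proof
    assume "span \<sigma> \<inter> W \<subseteq> {0}"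
    then have "span (span \<sigma> \<inter> W) \<subseteq> {0}"
      by (intro span_minimal subspace_single_0)
    then have "span \<sigma> \<subseteq> {0}"
      using polycone_span_rational[OF assms(1)] by (rule subset_trans[rotated])
    then show False
      using assms polycone_0 span_superset[of \<sigma>] by blast
  qed
  then show thesis
    using that by blast
qed

text \<open>All defining functionals vanish at \<open>v\<close>, being nonnegative at both
  \<open>v\<close> and \<open>- v\<close>. Their common zero set is therefore nonzero, and it is
  spanned by vectors of \<open>W\<close>, each of which has its whole line in \<sigma>.\<close>

lemma polycone_rational_line:
  assumes "polycone W \<sigma>" "v \<in> \<sigma>" "- v \<in> \<sigma>" "v \<noteq> 0"
  obtains w where "w \<in> W" "w \<noteq> 0" "span {w} \<subseteq> \<sigma>"
proof -
  obtain F where F: "finite F" "\<forall>f\<in>F. rational_functional f" "\<sigma> = {x. \<forall>f\<in>F. 0 \<le> f x}"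
    using assms(1) unfolding polycone_iff by blast
  have lin: "linear f" if "f \<in> F" for f
    using F(2) that by (auto simp: rational_functional_def)
  have "f v = 0" if "f \<in> F" for f
    using assms(2,3) F(3) that lin[OF that] by (force simp: linear_neg)
  then have "v \<in> span {w\<in>W. \<forall>f\<in>F. f w = 0}"
    using zeros_rational[OF F(1)] F(2) by blast
  moreover have "span {w\<in>W. \<forall>f\<in>F. f w = 0} \<subseteq> {0}" if "{w\<in>W. \<forall>f\<in>F. f w = 0} \<subseteq> {0}"
    using span_mono[OF that] by simp
  ultimately obtain w where w: "w \<in> W" "w \<noteq> 0" "\<forall>f\<in>F. f w = 0"
    using assms(4) by blast
  then have "span {w} \<subseteq> \<sigma>"
    using lin by (auto simp: F(3) span_singleton linear_scale)
  then show thesis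
    using that w by blast
qed

end

subsection \<open>Direct sums of families\<close>

text \<open>This is the direct sum of two cones without an index set;
  \<open>is_direct_sum_bool\<close> ties it to the boolean family in
  \<open>decomposable\<close>.\<close>

definition split_sum :: "'a::real_vector set \<Rightarrow> 'a set \<Rightarrow> 'a set \<Rightarrow> bool" where
  "split_sum \<sigma> \<tau> \<rho> \<longleftrightarrow> span \<tau> \<inter> span \<rho> \<subseteq> {0} \<and> \<sigma> = {a + b | a b. a \<in> \<tau> \<and> b \<in> \<rho>}"

lemma split_sum_commute:
  assumes "split_sum \<sigma> \<tau> \<rho>"
  shows "split_sum \<sigma> \<rho> \<tau>"
proof -
  have "{a + b | a b. a \<in> \<tau> \<and> b \<in> \<rho>} = {a + b | a b. a \<in> \<rho> \<and> b \<in> \<tau>}"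
    by (metis add.commute)
  then show ?thesis
    using assms by (auto simp: split_sum_def)
qed

lemma split_sum_subset: "split_sum \<sigma> \<tau> \<rho> \<Longrightarrow> 0 \<in> \<rho> \<Longrightarrow> \<tau> \<subseteq> \<sigma>"
  unfolding split_sum_def by force

lemma split_sum_eq_0:
  assumes "split_sum \<sigma> \<tau> \<rho>" "a \<in> span \<tau>" "b \<in> span \<rho>" "a + b = 0"
  shows "a = 0" "b = 0"
proof -
  have "a = - b"
    using assms(4) by (simp add: eq_neg_iff_add_eq_0)
  then have "a \<in> span \<rho>"
    using assms(3) by (simp add: span_neg)
  then show "a = 0"
    using assms(1,2) by (auto simp: split_sum_def)
  then show "b = 0"
    using assms(4) by simp
qed

section \<open>Sums over index families\<close>

lemma family_sumI: "finite J \<Longrightarrow> J \<subseteq> I \<Longrightarrow> (\<And>i. i \<in> J \<Longrightarrow> x i \<in> S i) \<Longrightarrow> (\<Sum>i\<in>J. x i) \<in> family_sum I S"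
  unfolding family_sum_def by blast

text \<open>Padding with zeros makes the representation valid over every finite index set containing
  \<open>J\<close>, so that two elements can be written over a common one.\<close>

lemma family_sumE:
  assumes "v \<in> family_sum I S" "\<And>i. i \<in> I \<Longrightarrow> 0 \<in> S i"
  obtains J x where "finite J" "J \<subseteq> I" "\<And>i. i \<in> I \<Longrightarrow> x i \<in> S i"
    "\<And>L. finite L \<Longrightarrow> J \<subseteq> L \<Longrightarrow> v = (\<Sum>i\<in>L. x i)"
proof -
  obtain J y where J: "finite J" "J \<subseteq> I" "\<And>i. i \<in> J \<Longrightarrow> y i \<in> S i" "v = (\<Sum>i\<in>J. y i)"
    using assms(1) unfolding family_sum_def by blast
  define x where "x i = (if i \<in> J then y i else 0)" for i
  have "v = (\<Sum>i\<in>L. x i)" if "finite L" "J \<subseteq> L" for L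
  proof -
    have "v = (\<Sum>i\<in>J. x i)"
      by (simp add: J(4) x_def)
    also have "\<dots> = (\<Sum>i\<in>L. x i)"
      using that by (intro sum.mono_neutral_left) (auto simp: x_def)
    finally show ?thesis .
  qed
  then show thesis
    using that[of J x] J(1-3) assms(2) by (simp add: x_def)
qed

lemma family_sum_member:
  assumes "i \<in> I"
  shows "S i \<subseteq> family_sum I S"
proof
  fix v assume "v \<in> S i"
  then have "(\<Sum>j\<in>{i}. v) \<in> family_sum I S"
    using assms by (intro family_sumI) auto
  then show "v \<in> family_sum I S"
    by simp
qed

lemma family_sum_add:
  assumes "\<And>i. i \<in> I \<Longrightarrow> convex_cone (S i)" "u \<in> family_sum I S" "v \<in> family_sum I S"
  shows "u + v \<in> family_sum I S"
proof -
  have zero: "0 \<in> S i" if "i \<in> I" for i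
    using assms(1)[OF that] by (simp add: convex_cone_iff)
  obtain J x where J: "finite J" "J \<subseteq> I" "\<And>i. i \<in> I \<Longrightarrow> x i \<in> S i"
    "\<And>L. finite L \<Longrightarrow> J \<subseteq> L \<Longrightarrow> u = (\<Sum>i\<in>L. x i)"
    using family_sumE[OF assms(2) zero] by metis
  obtain J' y where J': "finite J'" "J' \<subseteq> I" "\<And>i. i \<in> I \<Longrightarrow> y i \<in> S i"
    "\<And>L. finite L \<Longrightarrow> J' \<subseteq> L \<Longrightarrow> v = (\<Sum>i\<in>L. y i)"
    using family_sumE[OF assms(3) zero] by metis
  have "u + v = (\<Sum>i\<in>J \<union> J'. x i + y i)"
    using J(4)[of "J \<union> J'"] J'(4)[of "J \<union> J'"] J(1) J'(1) by (simp add: sum.distrib)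
  also have "\<dots> \<in> family_sum I S"
    using J J' assms(1) by (intro family_sumI convex_cone_add) auto
  finally show ?thesis .
qed

lemma family_sum_convex_cone:
  assumes "\<And>i. i \<in> I \<Longrightarrow> convex_cone (S i)"
  shows "convex_cone (family_sum I S)"
  unfolding convex_cone_iff
proof (intro conjI ballI allI impI)
  show "0 \<in> family_sum I S"
    using family_sumI[of "{}" I] by simp
  show "u + v \<in> family_sum I S" if "u \<in> family_sum I S" "v \<in> family_sum I S" for u v
    using family_sum_add[OF assms that] by blast
  show "c *\<^sub>R v \<in> family_sum I S" if v: "v \<in> family_sum I S" and c: "0 \<le> c" for v c
  proof -
    obtain J x where J: "finite J" "J \<subseteq> I" "\<And>i. i \<in> J \<Longrightarrow> x i \<in> S i" "v = (\<Sum>i\<in>J. x i)"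
      using v unfolding family_sum_def by blast
    then have "c *\<^sub>R v = (\<Sum>i\<in>J. c *\<^sub>R x i)"
      by (simp add: scaleR_sum_right)
    also have "\<dots> \<in> family_sum I S"
      using J c assms by (intro family_sumI convex_cone_scaleR) auto
    finally show ?thesis .
  qed
qed

lemma span_family_sum: "span (family_sum I S) \<subseteq> family_sum I (\<lambda>i. span (S i))"
proof (rule span_minimal)
  show "family_sum I S \<subseteq> family_sum I (\<lambda>i. span (S i))"
    unfolding family_sum_def using span_base by blast
  have cone: "convex_cone (span (S i))" for i
    by (auto simp: convex_cone_iff span_zero span_add span_scale)
  show "subspace (family_sum I (\<lambda>i. span (S i)))"
    unfolding subspace_def
  proof (intro conjI ballI allI)
    show "0 \<in> family_sum I (\<lambda>i. span (S i))"
      using family_sumI[of "{}" I] by simp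
    show "u + v \<in> family_sum I (\<lambda>i. span (S i))"
      if "u \<in> family_sum I (\<lambda>i. span (S i))" "v \<in> family_sum I (\<lambda>i. span (S i))" for u v
      using family_sum_add[OF cone that] by blast
    show "c *\<^sub>R v \<in> family_sum I (\<lambda>i. span (S i))" if v: "v \<in> family_sum I (\<lambda>i. span (S i))" for c v
    proof -
      obtain J x where J: "finite J" "J \<subseteq> I" "\<And>i. i \<in> J \<Longrightarrow> x i \<in> span (S i)" "v = (\<Sum>i\<in>J. x i)"
        using v unfolding family_sum_def by blast
      then have "c *\<^sub>R v = (\<Sum>i\<in>J. c *\<^sub>R x i)"
        by (simp add: scaleR_sum_right)
      also have "\<dots> \<in> family_sum I (\<lambda>i. span (S i))"
        using J by (intro family_sumI span_scale) auto
      finally show ?thesis .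
    qed
  qed
qed

lemma direct_familyD:
  assumes "direct_family I S" "finite J" "J \<subseteq> I" "\<And>i. i \<in> J \<Longrightarrow> x i \<in> span (S i)"
    "(\<Sum>i\<in>J. x i) = 0" "i \<in> J"
  shows "x i = 0"
  using assms unfolding direct_family_def by blast

lemma is_direct_sum_split:
  assumes "is_direct_sum \<sigma> I S" "i \<in> I" "\<And>j. j \<in> I \<Longrightarrow> convex_cone (S j)"
  shows "split_sum \<sigma> (S i) (family_sum (I - {i}) S)"
  unfolding split_sum_def
proof (intro conjI)
  have dir: "direct_family I S" and \<sigma>: "\<sigma> = family_sum I S"
    using assms(1) by (auto simp: is_direct_sum_def)
  have zero: "0 \<in> S j" if "j \<in> I" for j
    using assms(3)[OF that] by (simp add: convex_cone_iff)
  show "span (S i) \<inter> span (family_sum (I - {i}) S) \<subseteq> {0}"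
  proof
    fix v assume v: "v \<in> span (S i) \<inter> span (family_sum (I - {i}) S)"
    then have "v \<in> family_sum (I - {i}) (\<lambda>i. span (S i))"
      using span_family_sum by blast
    then obtain J x where J: "finite J" "J \<subseteq> I - {i}" "\<And>j. j \<in> J \<Longrightarrow> x j \<in> span (S j)"
      "v = (\<Sum>j\<in>J. x j)"
      unfolding family_sum_def by blast
    \<comment> \<open>A vector common to both spans gives a relation: its expansion over the other
      members together with \<open>- v\<close> at \<open>i\<close> sums to zero.\<close>
    define y where "y = x(i := - v)"
    have "(\<Sum>j\<in>J. y j) = v"
      unfolding J(4) using J(2) by (intro sum.cong) (auto simp: y_def)
    then have "(\<Sum>j\<in>insert i J. y j) = 0"
      using J(1,2) by (subst sum.insert) (auto simp: y_def)
    moreover have "y j \<in> span (S j)" if "j \<in> insert i J" for j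
      using that v J(3) by (auto simp: y_def span_neg)
    ultimately have "y i = 0"
      using direct_familyD[OF dir, of "insert i J" y i] J(1,2) assms(2) by auto
    then show "v \<in> {0}"
      by (simp add: y_def)
  qed
  show "\<sigma> = {a + b | a b. a \<in> S i \<and> b \<in> family_sum (I - {i}) S}"
  proof (intro equalityI subsetI)
    fix v assume "v \<in> \<sigma>"
    then have "v \<in> family_sum I S"
      by (simp add: \<sigma>)
    then obtain J x where J: "finite J" "J \<subseteq> I" "\<And>j. j \<in> I \<Longrightarrow> x j \<in> S j"
      "\<And>L. finite L \<Longrightarrow> J \<subseteq> L \<Longrightarrow> v = (\<Sum>j\<in>L. x j)"
      using family_sumE[of v I S] zero by metis
    have "v = (\<Sum>j\<in>insert i J. x j)"
      using J(1) by (intro J(4)) auto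
    also have "\<dots> = x i + (\<Sum>j\<in>J - {i}. x j)"
      using J(1) by (simp add: sum.insert_remove)
    finally have "v = x i + (\<Sum>j\<in>J - {i}. x j)" .
    moreover have "(\<Sum>j\<in>J - {i}. x j) \<in> family_sum (I - {i}) S"
      using J by (intro family_sumI) auto
    ultimately show "v \<in> {a + b | a b. a \<in> S i \<and> b \<in> family_sum (I - {i}) S}"
      using J(3)[OF assms(2)] by blast
  next
    fix v assume "v \<in> {a + b | a b. a \<in> S i \<and> b \<in> family_sum (I - {i}) S}"
    then obtain a b where ab: "v = a + b" "a \<in> S i" "b \<in> family_sum (I - {i}) S"
      by blast
    have "family_sum (I - {i}) S \<subseteq> family_sum I S"
      unfolding family_sum_def by blast
    then show "v \<in> \<sigma>"
      unfolding \<sigma> ab(1) using ab(2,3) family_sum_member[OF assms(2), of S] assms(3)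
      by (intro family_sum_add) auto
  qed
qed

lemma is_direct_sum_singleton:
  assumes "0 \<in> S i"
  shows "is_direct_sum (S i) {i} S"
proof -
  have "direct_family {i} S"
    unfolding direct_family_def
  proof (intro allI impI ballI)
    fix J x j
    assume *: "finite J \<and> J \<subseteq> {i} \<and> (\<forall>i\<in>J. x i \<in> span (S i)) \<and> (\<Sum>i\<in>J. x i) = 0" and j: "j \<in> J"
    then have "J = {i}" "j = i"
      by auto
    then show "x j = 0"
      using * by simp
  qed
  moreover have "family_sum {i} S \<subseteq> S i"
  proof
    fix v assume "v \<in> family_sum {i} S"
    then obtain J x where J: "finite J" "J \<subseteq> {i}" "\<And>j. j \<in> J \<Longrightarrow> x j \<in> S j" "v = (\<Sum>j\<in>J. x j)"
      unfolding family_sum_def by blast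
    then show "v \<in> S i"
      using assms by (cases "i \<in> J") (auto simp: subset_singleton_iff)
  qed
  ultimately show ?thesis
    using family_sum_member[of i "{i}" S] unfolding is_direct_sum_def by auto
qed

text \<open>The two spans meet only in 0, so a vanishing sum over \<open>I \<union> J\<close>
  already vanishes over each part, where the directness of that part applies.\<close>

lemma is_direct_sum_union:
  fixes S :: "'i \<Rightarrow> 'a::real_vector set"
  assumes split: "split_sum \<sigma> \<tau> \<rho>"
    and I: "is_direct_sum \<tau> I S" and J: "is_direct_sum \<rho> J S" and disj: "I \<inter> J = {}"
  shows "is_direct_sum \<sigma> (I \<union> J) S"
proof -
  have dir: "direct_family I S" "direct_family J S" and \<tau>: "\<tau> = family_sum I S" and \<rho>: "\<rho> = family_sum J S"
    using I J by (auto simp: is_direct_sum_def)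
  have sum_split: "(\<Sum>i\<in>L. x i) = (\<Sum>i\<in>L \<inter> I. x i) + (\<Sum>i\<in>L \<inter> J. x i)"
    if "finite L" "L \<subseteq> I \<union> J" for L and x :: "_ \<Rightarrow> 'a"
  proof -
    have "L = (L \<inter> I) \<union> (L \<inter> J)"
      using that(2) by blast
    then show ?thesis
      using that(1) disj by (metis (no_types, lifting) sum.union_disjoint finite_Int inf_assoc
        inf_bot_right inf_left_commute)
  qed
  have span_sub: "span (S i) \<subseteq> span \<tau>" if "i \<in> I" for i
    using family_sum_member[OF that] unfolding \<tau> by (rule span_mono)
  have span_sub': "span (S i) \<subseteq> span \<rho>" if "i \<in> J" for i
    using family_sum_member[OF that] unfolding \<rho> by (rule span_mono)
  have "direct_family (I \<union> J) S"
    unfolding direct_family_def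
  proof (intro allI impI ballI)
    fix L x i
    assume *: "finite L \<and> L \<subseteq> I \<union> J \<and> (\<forall>i\<in>L. x i \<in> span (S i)) \<and> (\<Sum>i\<in>L. x i) = 0" and i: "i \<in> L"
    have "(\<Sum>i\<in>L \<inter> I. x i) \<in> span \<tau>" "(\<Sum>i\<in>L \<inter> J. x i) \<in> span \<rho>"
      using * by (auto intro!: span_sum subsetD[OF span_sub] subsetD[OF span_sub'])
    then have "(\<Sum>i\<in>L \<inter> I. x i) = 0" "(\<Sum>i\<in>L \<inter> J. x i) = 0"
      using split_sum_eq_0[OF split] sum_split[of L x] * by auto
    then show "x i = 0"
      using direct_familyD[OF dir(1), of "L \<inter> I" x i] direct_familyD[OF dir(2), of "L \<inter> J" x i] * i
      by blast
  qed
  moreover have "\<sigma> = family_sum (I \<union> J) S"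
  proof (intro equalityI subsetI)
    fix v assume "v \<in> \<sigma>"
    then obtain a b where ab: "v = a + b" "a \<in> family_sum I S" "b \<in> family_sum J S"
      using split unfolding split_sum_def \<tau> \<rho> by blast
    obtain L x where L: "finite L" "L \<subseteq> I" "\<And>i. i \<in> L \<Longrightarrow> x i \<in> S i" "a = (\<Sum>i\<in>L. x i)"
      using ab(2) unfolding family_sum_def by blast
    obtain M y where M: "finite M" "M \<subseteq> J" "\<And>i. i \<in> M \<Longrightarrow> y i \<in> S i" "b = (\<Sum>i\<in>M. y i)"
      using ab(3) unfolding family_sum_def by blast
    define z where "z i = (if i \<in> L then x i else y i)" for i
    have "(\<Sum>i\<in>L. z i) = a"
      by (simp add: L(4) z_def)
    moreover have "(\<Sum>i\<in>M. z i) = b"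
      unfolding M(4) using L(2) M(2) disj by (intro sum.cong) (auto simp: z_def)
    ultimately have "v = (\<Sum>i\<in>L \<union> M. z i)"
      using L(1,2) M(1,2) disj by (subst sum.union_disjoint) (auto simp: ab(1))
    also have "\<dots> \<in> family_sum (I \<union> J) S"
      using L M by (intro family_sumI) (auto simp: z_def)
    finally show "v \<in> family_sum (I \<union> J) S" .
  next
    fix v assume "v \<in> family_sum (I \<union> J) S"
    then obtain L x where L: "finite L" "L \<subseteq> I \<union> J" "\<And>i. i \<in> L \<Longrightarrow> x i \<in> S i" "v = (\<Sum>i\<in>L. x i)"
      unfolding family_sum_def by blast
    have "(\<Sum>i\<in>L \<inter> I. x i) \<in> \<tau>" "(\<Sum>i\<in>L \<inter> J. x i) \<in> \<rho>"
      unfolding \<tau> \<rho> using L by (auto intro!: family_sumI)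
    then show "v \<in> \<sigma>"
      using split sum_split[OF L(1,2), of x] L(4) unfolding split_sum_def by blast
  qed
  ultimately show ?thesis
    by (simp add: is_direct_sum_def)
qed

lemma is_direct_sum_bool:
  assumes "convex_cone \<tau>" "convex_cone \<rho>"
  shows "is_direct_sum \<sigma> UNIV (\<lambda>b::bool. if b then \<tau> else \<rho>) \<longleftrightarrow> split_sum \<sigma> \<tau> \<rho>"
proof -
  let ?S = "\<lambda>b::bool. if b then \<tau> else \<rho>"
  have zero: "0 \<in> \<tau>" "0 \<in> \<rho>"
    using assms by (auto simp: convex_cone_iff)
  have sing: "is_direct_sum \<tau> {True} ?S" "is_direct_sum \<rho> {False} ?S"
    using is_direct_sum_singleton[of ?S True] is_direct_sum_singleton[of ?S False] zero by auto
  have compl: "UNIV - {True} = {False}" "UNIV = {True} \<union> {False}"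
    by auto
  show ?thesis
  proof
    assume "is_direct_sum \<sigma> UNIV ?S"
    then show "split_sum \<sigma> \<tau> \<rho>"
      using is_direct_sum_split[of \<sigma> UNIV ?S True] sing(2) assms
      unfolding compl(1) is_direct_sum_def by simp
  next
    assume "split_sum \<sigma> \<tau> \<rho>"
    then show "is_direct_sum \<sigma> UNIV ?S"
      unfolding compl(2) by (intro is_direct_sum_union[OF _ sing]) auto
  qed
qed

lemma is_direct_sum_image:
  assumes T: "linear T" "inj T" and sum: "is_direct_sum \<sigma> I S"
  shows "is_direct_sum (T ` \<sigma>) I (\<lambda>i. T ` S i)"
proof -
  have dir: "direct_family I S" and \<sigma>: "\<sigma> = family_sum I S"
    using sum by (auto simp: is_direct_sum_def)
  have "direct_family I (\<lambda>i. T ` S i)"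
    unfolding direct_family_def
  proof (intro allI impI ballI)
    fix J x i
    assume *: "finite J \<and> J \<subseteq> I \<and> (\<forall>i\<in>J. x i \<in> span (T ` S i)) \<and> (\<Sum>i\<in>J. x i) = 0" and i: "i \<in> J"
    then have "\<forall>i\<in>J. \<exists>y\<in>span (S i). x i = T y"
      using linear_span_image[OF T(1)] by blast
    then obtain y where y: "\<And>i. i \<in> J \<Longrightarrow> y i \<in> span (S i) \<and> x i = T (y i)"
      by metis
    have "T (\<Sum>i\<in>J. y i) = T 0"
      using * y by (simp add: linear_sum[OF T(1)] linear_0[OF T(1)])
    then have "(\<Sum>i\<in>J. y i) = 0"
      using T(2) by (simp add: inj_eq)
    then have "y i = 0"
      using direct_familyD[OF dir, of J y i] * y i by blast
    then show "x i = 0"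
      using y[OF i] by (simp add: linear_0[OF T(1)])
  qed
  moreover have "T ` \<sigma> = family_sum I (\<lambda>i. T ` S i)"
  proof (intro equalityI subsetI)
    fix v assume "v \<in> T ` \<sigma>"
    then obtain u where u: "v = T u" "u \<in> family_sum I S"
      using \<sigma> by blast
    then obtain J x where J: "finite J" "J \<subseteq> I" "\<And>i. i \<in> J \<Longrightarrow> x i \<in> S i" "u = (\<Sum>i\<in>J. x i)"
      unfolding family_sum_def by blast
    have "v = (\<Sum>i\<in>J. T (x i))"
      using u(1) J(4) by (simp add: linear_sum[OF T(1)])
    also have "\<dots> \<in> family_sum I (\<lambda>i. T ` S i)"
      using J by (intro family_sumI) auto
    finally show "v \<in> family_sum I (\<lambda>i. T ` S i)" .
  next
    fix v assume "v \<in> family_sum I (\<lambda>i. T ` S i)"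
    then obtain J x where J: "finite J" "J \<subseteq> I" "\<And>i. i \<in> J \<Longrightarrow> x i \<in> T ` S i" "v = (\<Sum>i\<in>J. x i)"
      unfolding family_sum_def by blast
    then obtain y where y: "\<And>i. i \<in> J \<Longrightarrow> y i \<in> S i \<and> x i = T (y i)"
      unfolding image_iff by metis
    have "v = T (\<Sum>i\<in>J. y i)"
      using J(4) y by (simp add: linear_sum[OF T(1)])
    moreover have "(\<Sum>i\<in>J. y i) \<in> \<sigma>"
      unfolding \<sigma> using J y by (intro family_sumI) auto
    ultimately show "v \<in> T ` \<sigma>"
      by blast
  qed
  ultimately show ?thesis
    by (simp add: is_direct_sum_def)
qed

text \<open>A decomposition is a set of cones indexed by itself. Moving it by a map changes the
  index set too, and this accounts for that change.\<close>

lemma is_direct_sum_reindex: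
  fixes S :: "'j \<Rightarrow> 'a::real_vector set"
  assumes h: "inj_on h I" and sum: "is_direct_sum \<sigma> I (\<lambda>i. S (h i))"
  shows "is_direct_sum \<sigma> (h ` I) S"
proof -
  have dir: "direct_family I (\<lambda>i. S (h i))" and \<sigma>: "\<sigma> = family_sum I (\<lambda>i. S (h i))"
    using sum by (auto simp: is_direct_sum_def)
  have reindex: "(\<Sum>j\<in>h ` J. x j) = (\<Sum>i\<in>J. x (h i))" if "J \<subseteq> I" for J and x :: "_ \<Rightarrow> 'a"
    using sum.reindex[OF inj_on_subset[OF h that]] by (simp add: o_def)
  have fin: "finite (h ` J) \<longleftrightarrow> finite J" if "J \<subseteq> I" for J
    using finite_image_iff[OF inj_on_subset[OF h that]] .
  have "direct_family (h ` I) S"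
    unfolding direct_family_def
  proof (intro allI impI ballI)
    fix L x j
    assume *: "finite L \<and> L \<subseteq> h ` I \<and> (\<forall>i\<in>L. x i \<in> span (S i)) \<and> (\<Sum>i\<in>L. x i) = 0" and j: "j \<in> L"
    then obtain J where J: "J \<subseteq> I" "L = h ` J"
      by (meson subset_imageE)
    obtain i where i: "i \<in> J" "j = h i"
      using j J(2) by blast
    show "x j = 0"
      using direct_familyD[OF dir, of J "\<lambda>i. x (h i)" i] * J i reindex[OF J(1), of x] fin[OF J(1)] by auto
  qed
  moreover have "family_sum I (\<lambda>i. S (h i)) = family_sum (h ` I) S"
  proof (intro equalityI subsetI)
    fix v assume "v \<in> family_sum I (\<lambda>i. S (h i))"
    then obtain J x where J: "finite J" "J \<subseteq> I" "\<And>i. i \<in> J \<Longrightarrow> x i \<in> S (h i)" "v = (\<Sum>i\<in>J. x i)"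
      unfolding family_sum_def by blast
    define y where "y j = x (the_inv_into I h j)" for j
    have y: "y (h i) = x i" if "i \<in> J" for i
      using that J(2) h by (auto simp: y_def the_inv_into_f_f)
    have "v = (\<Sum>j\<in>h ` J. y j)"
      using J(4) reindex[OF J(2), of y] y by simp
    also have "\<dots> \<in> family_sum (h ` I) S"
      using J y by (intro family_sumI) auto
    finally show "v \<in> family_sum (h ` I) S" .
  next
    fix v assume "v \<in> family_sum (h ` I) S"
    then obtain L x where L: "finite L" "L \<subseteq> h ` I" "\<And>i. i \<in> L \<Longrightarrow> x i \<in> S i" "v = (\<Sum>i\<in>L. x i)"
      unfolding family_sum_def by blast
    then obtain J where J: "J \<subseteq> I" "L = h ` J"
      by (meson subset_imageE)
    have "v = (\<Sum>i\<in>J. x (h i))"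
      using L(4) J reindex by simp
    also have "\<dots> \<in> family_sum I (\<lambda>i. S (h i))"
      using L J fin[OF J(1)] by (intro family_sumI) auto
    finally show "v \<in> family_sum I (\<lambda>i. S (h i))" .
  qed
  ultimately show ?thesis
    by (simp add: is_direct_sum_def \<sigma>)
qed

section \<open>Spans of distinct members of a direct family\<close>

lemma direct_family_disjoint:
  assumes "direct_family Z (\<lambda>\<tau>. \<tau>)" "\<tau> \<in> Z" "\<rho> \<in> Z" "\<tau> \<noteq> \<rho>" "v \<in> span \<tau>" "v \<in> span \<rho>"
  shows "v = 0"
proof -
  define x where "x \<kappa> = (if \<kappa> = \<tau> then v else - v)" for \<kappa>
  have "(\<Sum>\<kappa>\<in>{\<tau>, \<rho>}. x \<kappa>) = 0"
    using assms(4) by (auto simp: x_def)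
  moreover have "x \<kappa> \<in> span \<kappa>" if "\<kappa> \<in> {\<tau>, \<rho>}" for \<kappa>
    using that assms(5) span_neg[OF assms(6)] by (auto simp: x_def)
  ultimately have "x \<tau> = 0"
    using assms(2,3) by (intro direct_familyD[OF assms(1), of "{\<tau>, \<rho>}" x \<tau>]) auto
  then show ?thesis
    by (simp add: x_def)
qed

text \<open>A vector with nonzero components in two different members cannot lie in the span of a
  single one. In the shear argument this shows that the image of a member is not a member.\<close>

lemma direct_family_sum_notin:
  assumes dir: "direct_family Z (\<lambda>\<tau>. \<tau>)" and Z: "\<tau> \<in> Z" "\<rho> \<in> Z" "\<kappa> \<in> Z" and ne: "\<tau> \<noteq> \<rho>"
    and uv: "u \<in> span \<tau>" "v \<in> span \<rho>" "u \<noteq> 0" "v \<noteq> 0"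
  shows "u + v \<notin> span \<kappa>"
proof
  assume in_span: "u + v \<in> span \<kappa>"
  consider "\<kappa> = \<tau>" | "\<kappa> = \<rho>" | "\<kappa> \<noteq> \<tau>" "\<kappa> \<noteq> \<rho>"
    by blast
  then show False
  proof cases
    case 1
    then have "v \<in> span \<tau>"
      using span_diff[OF in_span, of u] uv(1) by simp
    then show False
      using direct_family_disjoint[OF dir Z(1,2) ne] uv by blast
  next
    case 2
    then have "u \<in> span \<rho>"
      using span_diff[OF in_span, of v] uv(2) by simp
    then show False
      using direct_family_disjoint[OF dir Z(1,2) ne] uv by blast
  next
    case 3
    define x where "x \<iota> = (if \<iota> = \<tau> then u else if \<iota> = \<rho> then v else - (u + v))" for \<iota>
    have "(\<Sum>\<iota>\<in>{\<tau>, \<rho>, \<kappa>}. x \<iota>) = 0"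
      using 3 ne by (auto simp: x_def)
    moreover have "x \<iota> \<in> span \<iota>" if "\<iota> \<in> {\<tau>, \<rho>, \<kappa>}" for \<iota>
      using that uv(1,2) span_neg[OF in_span] by (auto simp: x_def)
    ultimately have "x \<tau> = 0"
      using Z by (intro direct_familyD[OF dir, of "{\<tau>, \<rho>, \<kappa>}" x \<tau>]) auto
    then show False
      using uv(3) by (simp add: x_def)
  qed
qed

section \<open>Lines, sharpness and faces\<close>

lemma is_line_iff: "is_line L \<longleftrightarrow> (\<exists>v. v \<noteq> 0 \<and> L = span {v})"
proof
  assume L: "is_line L"
  obtain B where B: "B \<subseteq> L" "independent B" "L \<subseteq> span B" "card B = dim L"
    using real_vector.basis_exists by blast
  then obtain v where v: "B = {v}"
    using L by (auto simp: is_line_def card_1_singleton_iff)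
  have "span {v} \<subseteq> L"
    using L B(1) v by (intro span_minimal) (auto simp: is_line_def)
  then show "\<exists>v. v \<noteq> 0 \<and> L = span {v}"
    using B v by (intro exI[of _ v]) auto
next
  assume "\<exists>v. v \<noteq> 0 \<and> L = span {v}"
  then obtain v where "v \<noteq> 0" "L = span {v}"
    by blast
  then show "is_line L"
    by (simp add: is_line_def real_vector.dim_eq_card_independent)
qed

lemma sharp_iff:
  assumes "convex_cone \<sigma>"
  shows "sharp \<sigma> \<longleftrightarrow> (\<forall>v\<in>\<sigma>. - v \<in> \<sigma> \<longrightarrow> v = 0)"
proof
  assume sharp: "sharp \<sigma>"
  show "\<forall>v\<in>\<sigma>. - v \<in> \<sigma> \<longrightarrow> v = 0"
  proof (intro ballI impI, rule ccontr)
    fix v assume v: "v \<in> \<sigma>" "- v \<in> \<sigma>" "v \<noteq> 0"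
    have "k *\<^sub>R v \<in> \<sigma>" for k
    proof (cases "0 \<le> k")
      case True
      then show ?thesis
        using convex_cone_scaleR[OF assms _ v(1)] by blast
    next
      case False
      then show ?thesis
        using convex_cone_scaleR[OF assms _ v(2), of "- k"] by simp
    qed
    then have "span {v} \<subseteq> \<sigma>"
      by (auto simp: span_singleton)
    then show False
      using sharp v(3) unfolding sharp_def is_line_iff by blast
  qed
next
  assume *: "\<forall>v\<in>\<sigma>. - v \<in> \<sigma> \<longrightarrow> v = 0"
  show "sharp \<sigma>"
    unfolding sharp_def is_line_iff
  proof
    assume "\<exists>L. (\<exists>v. v \<noteq> 0 \<and> L = span {v}) \<and> L \<subseteq> \<sigma>"
    then obtain v where v: "v \<noteq> 0" "span {v} \<subseteq> \<sigma>"
      by blast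
    have "v \<in> span {v}"
      by (simp add: span_base)
    then show False
      using * v span_neg by blast
  qed
qed

text \<open>The \<rho>-components \<open>q\<close> and \<open>s\<close> of \<open>a\<close> and
  \<open>b\<close> add up to a vector of \<open>span \<tau> \<inter> span \<rho>\<close>, hence to
  0. Both lie in \<sigma>, so \<open>q\<close> and \<open>- q\<close> are in \<sigma>, and the
  absence of lines forces \<open>q = 0\<close>.\<close>

lemma split_sum_face:
  assumes split: "split_sum \<sigma> \<tau> \<rho>" and cone: "convex_cone \<tau>" "convex_cone \<rho>"
    and pointed: "\<forall>v\<in>\<sigma>. - v \<in> \<sigma> \<longrightarrow> v = 0"
    and ab: "a \<in> \<sigma>" "b \<in> \<sigma>" "a + b \<in> \<tau>"
  shows "a \<in> \<tau>"
proof -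
  obtain p q where p: "a = p + q" "p \<in> \<tau>" "q \<in> \<rho>"
    using ab(1) split unfolding split_sum_def by blast
  obtain r s where r: "b = r + s" "r \<in> \<tau>" "s \<in> \<rho>"
    using ab(2) split unfolding split_sum_def by blast
  have "p + r - (a + b) \<in> span \<tau>"
    by (intro span_add span_diff span_base p(2) r(2) ab(3))
  moreover have "q + s \<in> span \<rho>"
    by (intro span_add span_base p(3) r(3))
  moreover have "p + r - (a + b) + (q + s) = 0"
    by (simp add: p(1) r(1))
  ultimately have "q + s = 0"
    by (rule split_sum_eq_0(2)[OF split])
  then have "s = - q"
    by (simp add: eq_neg_iff_add_eq_0 add.commute)
  moreover have "q \<in> \<sigma>" "s \<in> \<sigma>"
    using split_sum_subset[OF split_sum_commute[OF split]] cone(1) p(3) r(3)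
    by (auto simp: convex_cone_iff)
  ultimately have "q = 0"
    using pointed by auto
  then show ?thesis
    using p by simp
qed

subsection \<open>Decompositions of polycones\<close>

context rational_structure
begin

section \<open>Splitting off members; existence\<close>

lemma decomposable_iff:
  "decomposable W \<sigma> \<longleftrightarrow>
     (\<exists>\<tau> \<rho>. polycone W \<tau> \<and> polycone W \<rho> \<and> \<tau> \<noteq> {0} \<and> \<rho> \<noteq> {0} \<and> split_sum \<sigma> \<tau> \<rho>)"
  unfolding decomposable_def using is_direct_sum_bool polycone_convex_cone by metis

text \<open>The sum of the remaining members is recorded only as a convex cone. That is enough to
  take components, and no inequalities for the sum are needed.\<close>

lemma decomposition_split:
  assumes "decomposition W \<sigma> Z" "\<tau> \<in> Z"
  shows "split_sum \<sigma> \<tau> (family_sum (Z - {\<tau>}) (\<lambda>\<tau>. \<tau>))"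
    and "convex_cone (family_sum (Z - {\<tau>}) (\<lambda>\<tau>. \<tau>))"
  using is_direct_sum_split[of \<sigma> Z "\<lambda>\<tau>. \<tau>" \<tau>] family_sum_convex_cone[of "Z - {\<tau>}" "\<lambda>\<tau>. \<tau>"]
    assms polycone_convex_cone by (auto simp: decomposition_def)

lemma decomposition_member:
  assumes "decomposition W \<sigma> Z" "\<tau> \<in> Z"
  shows "polycone W \<tau>" "\<not> decomposable W \<tau>" "\<tau> \<noteq> {0}" "\<tau> \<subseteq> \<sigma>"
  using assms family_sum_member[OF assms(2), of "\<lambda>\<tau>. \<tau>"] by (auto simp: decomposition_def is_direct_sum_def)

lemma decomposition_direct: "decomposition W \<sigma> Z \<Longrightarrow> direct_family Z (\<lambda>\<tau>. \<tau>)"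
  by (simp add: decomposition_def is_direct_sum_def)

lemma decomposition_component:
  assumes "decomposition W \<sigma> Z" "v \<in> \<sigma>" "v \<noteq> 0"
  obtains \<tau> a b where "\<tau> \<in> Z" "v = a + b" "a \<in> \<tau>" "a \<noteq> 0" "b \<in> family_sum (Z - {\<tau>}) (\<lambda>\<tau>. \<tau>)"
proof -
  have "v \<in> family_sum Z (\<lambda>\<tau>. \<tau>)"
    using assms by (simp add: decomposition_def is_direct_sum_def)
  then obtain J x where J: "finite J" "J \<subseteq> Z" "\<And>\<tau>. \<tau> \<in> J \<Longrightarrow> x \<tau> \<in> \<tau>" "v = (\<Sum>\<tau>\<in>J. x \<tau>)"
    unfolding family_sum_def by blast
  then obtain \<tau> where \<tau>: "\<tau> \<in> J" "x \<tau> \<noteq> 0"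
    using assms(3) sum.neutral[of J x] by blast
  have "v = x \<tau> + (\<Sum>\<tau>\<in>J - {\<tau>}. x \<tau>)"
    using J(1,4) \<tau>(1) by (simp add: sum.remove)
  moreover have "(\<Sum>\<tau>\<in>J - {\<tau>}. x \<tau>) \<in> family_sum (Z - {\<tau>}) (\<lambda>\<tau>. \<tau>)"
    using J by (intro family_sumI) auto
  ultimately show thesis
    using that J(2,3) \<tau> by blast
qed

text \<open>A nonzero vector of \<rho> is outside the span of \<tau>, so it enlarges a basis of
  \<tau>. This is the measure for the induction that produces decompositions.\<close>

lemma split_sum_dim_less:
  fixes \<sigma> \<tau> \<rho> :: "'a set"
  assumes "split_sum \<sigma> \<tau> \<rho>" "0 \<in> \<tau>" "0 \<in> \<rho>" "\<rho> \<noteq> {0}"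
  shows "dim \<tau> < dim \<sigma>"
proof -
  have sub: "\<tau> \<subseteq> \<sigma>" "\<rho> \<subseteq> \<sigma>"
    using split_sum_subset[OF assms(1)] split_sum_subset[OF split_sum_commute[OF assms(1)]] assms(2,3)
    by auto
  obtain w where w: "w \<in> \<rho>" "w \<noteq> 0"
    using assms(3,4) by blast
  obtain B where B: "B \<subseteq> \<tau>" "independent B" "\<tau> \<subseteq> span B" "card B = dim \<tau>"
    using real_vector.basis_exists by blast
  obtain C where C: "C \<subseteq> \<sigma>" "independent C" "\<sigma> \<subseteq> span C" "card C = dim \<sigma>"
    using real_vector.basis_exists by blast
  have "w \<notin> span \<tau>"
    using assms(1) w span_base unfolding split_sum_def by blast
  then have "w \<notin> span B"
    using span_mono[OF B(1)] by blast
  then have "independent (insert w B)" "w \<notin> B"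
    using independent_insertI[OF _ B(2)] span_base by blast+
  moreover have "insert w B \<subseteq> span C"
    using B(1) C(3) sub w(1) by blast
  ultimately have "card (insert w B) \<le> card C"
    using real_vector.independent_span_bound[OF independent_finite[OF C(2)]] by blast
  then show ?thesis
    using B(4) C(4) independent_finite[OF B(2)] \<open>w \<notin> B\<close> by simp
qed

lemma decomposition_exists:
  assumes "polycone W \<sigma>"
  shows "\<exists>Z. decomposition W \<sigma> Z"
  using assms
proof (induction "dim \<sigma>" arbitrary: \<sigma> rule: less_induct)
  case less
  consider "\<sigma> = {0}" | "\<sigma> \<noteq> {0}" "\<not> decomposable W \<sigma>" | "decomposable W \<sigma>"
    by blast
  then show ?case
  proof cases
    case 1
    then have "decomposition W \<sigma> {}"
      by (auto simp: decomposition_def is_direct_sum_def direct_family_def family_sum_def)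
    then show ?thesis
      by blast
  next
    case 2
    then have "decomposition W \<sigma> {\<sigma>}"
      using less.prems is_direct_sum_singleton[of "\<lambda>\<tau>. \<tau>" \<sigma>] polycone_0 by (auto simp: decomposition_def)
    then show ?thesis
      by blast
  next
    case 3
    then obtain \<tau> \<rho> where *: "polycone W \<tau>" "polycone W \<rho>" "\<tau> \<noteq> {0}" "\<rho> \<noteq> {0}" "split_sum \<sigma> \<tau> \<rho>"
      unfolding decomposable_iff by blast
    then have "dim \<tau> < dim \<sigma>" "dim \<rho> < dim \<sigma>"
      using split_sum_dim_less polycone_0 split_sum_commute by blast+
    then obtain X Y where X: "decomposition W \<tau> X" and Y: "decomposition W \<rho> Y"
      using less.hyps * by metis
    \<comment> \<open>Decompositions are sets, so a cone occurring in both halves would be counted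
      only once in the union. A common member would lie in \<open>\<tau> \<inter> \<rho>\<close>,
      hence be zero.\<close>
    have "\<kappa> = {0}" if "\<kappa> \<in> X" "\<kappa> \<in> Y" for \<kappa>
    proof -
      have "\<kappa> \<subseteq> \<tau>" "\<kappa> \<subseteq> \<rho>" "0 \<in> \<kappa>"
        using decomposition_member[OF X that(1)] decomposition_member[OF Y that(2)] polycone_0 by auto
      moreover have "\<tau> \<inter> \<rho> \<subseteq> {0}"
        using *(5) span_superset unfolding split_sum_def by blast
      ultimately show ?thesis
        by blast
    qed
    then have "X \<inter> Y = {}"
      using decomposition_member(3)[OF X] by blast
    then have "is_direct_sum \<sigma> (X \<union> Y) (\<lambda>\<tau>. \<tau>)"
      using is_direct_sum_union[OF *(5)] X Y by (auto simp: decomposition_def)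
    then have "decomposition W \<sigma> (X \<union> Y)"
      using X Y by (auto simp: decomposition_def)
    then show ?thesis
      by blast
  qed
qed

section \<open>Automorphisms preserving W, and non-sharp polycones\<close>

lemma decomposable_image:
  assumes T: "linear T" "linear S" "S ` W \<subseteq> W" "\<And>x. S (T x) = x" "\<And>x. T (S x) = x"
    and "decomposable W \<sigma>"
  shows "decomposable W (T ` \<sigma>)"
proof -
  obtain \<tau> \<rho> where *: "polycone W \<tau>" "polycone W \<rho>" "\<tau> \<noteq> {0}" "\<rho> \<noteq> {0}"
    "is_direct_sum \<sigma> UNIV (\<lambda>b::bool. if b then \<tau> else \<rho>)"
    using assms(6) unfolding decomposable_def by blast
  have "inj T"
    by (rule inj_on_inverseI[of _ S]) (simp add: T(4))
  have ne: "T ` \<kappa> \<noteq> {0}" if "\<kappa> \<noteq> {0}" for \<kappa>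
    using that inj_image_eq_iff[OF \<open>inj T\<close>, of \<kappa> "{0}"] linear_0[OF T(1)] by simp
  have "(\<lambda>b. T ` (if b then \<tau> else \<rho>)) = (\<lambda>b::bool. if b then T ` \<tau> else T ` \<rho>)"
    by (simp add: fun_eq_iff)
  then have "is_direct_sum (T ` \<sigma>) UNIV (\<lambda>b::bool. if b then T ` \<tau> else T ` \<rho>)"
    using is_direct_sum_image[OF T(1) \<open>inj T\<close> *(5)] by simp
  then show ?thesis
    unfolding decomposable_def
    by (intro exI[of _ "T ` \<tau>"] exI[of _ "T ` \<rho>"] conjI polycone_image[OF T(2-5)] ne *(1-4))
qed

text \<open>Images remain polycones because \<open>S\<close> preserves \<open>W\<close>. They remain
  indecomposable because a splitting of an image could be carried back by \<open>S\<close>, which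
  requires \<open>T\<close> to preserve \<open>W\<close> as well.\<close>

lemma decomposition_image:
  assumes T: "linear T" "linear S" "T ` W \<subseteq> W" "S ` W \<subseteq> W" "\<And>x. S (T x) = x" "\<And>x. T (S x) = x"
    and Z: "decomposition W \<sigma> Z"
  shows "decomposition W (T ` \<sigma>) ((`) T ` Z)"
proof -
  have inj: "inj T"
    by (rule inj_on_inverseI[of _ S]) (simp add: T(5))
  have ST: "S ` T ` \<tau> = \<tau>" for \<tau>
    using T(5) by (simp add: image_image)
  have "polycone W (T ` \<tau>) \<and> \<not> decomposable W (T ` \<tau>) \<and> T ` \<tau> \<noteq> {0}" if "\<tau> \<in> Z" for \<tau>
  proof (intro conjI notI)
    show "polycone W (T ` \<tau>)"
      using polycone_image[OF T(2,4-6)] decomposition_member(1)[OF Z that] .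
    show False if "decomposable W (T ` \<tau>)"
      using decomposable_image[OF T(2,1,3,6,5) that] decomposition_member(2)[OF Z \<open>\<tau> \<in> Z\<close>] ST by simp
    show False if "T ` \<tau> = {0}"
      using ST[of \<tau>] that decomposition_member(3)[OF Z \<open>\<tau> \<in> Z\<close>] linear_0[OF T(2)] by simp
  qed
  moreover have "is_direct_sum (T ` \<sigma>) ((`) T ` Z) (\<lambda>\<tau>. \<tau>)"
  proof (rule is_direct_sum_reindex)
    show "inj_on ((`) T) Z"
      using inj by (meson inj_image_eq_iff inj_onI)
    show "is_direct_sum (T ` \<sigma>) Z ((`) T)"
      using is_direct_sum_image[OF T(1) inj, of \<sigma> Z "\<lambda>\<tau>. \<tau>"] Z by (simp add: decomposition_def)
  qed
  ultimately show ?thesis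
    by (auto simp: decomposition_def)
qed

text \<open>Take a rational \<open>w\<close> whose line lies in \<sigma> and a rational functional
  \<open>g\<close> with \<open>g w = 1\<close>. Subtracting \<open>g x\<close> times
  \<open>w\<close> keeps \<open>x\<close> in \<sigma>, so \<sigma> is the direct sum of this line
  and its section \<rho> by the kernel of \<open>g\<close>. Both summands are polycones by
  construction, so indecomposability forces \<rho> to be zero.\<close>

lemma indecomposable_line:
  assumes "polycone W \<sigma>" "\<not> decomposable W \<sigma>" "\<not> sharp \<sigma>"
  shows "is_line \<sigma>"
proof -
  have cone: "convex_cone \<sigma>"
    using polycone_convex_cone[OF assms(1)] .
  obtain v where v: "v \<in> \<sigma>" "- v \<in> \<sigma>" "v \<noteq> 0"
    using assms(3) sharp_iff[OF cone] by blast
  obtain w where w: "w \<in> W" "w \<noteq> 0" "span {w} \<subseteq> \<sigma>"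
    using polycone_rational_line[OF assms(1) v] .
  obtain g where g: "rational_functional g" "g w = 1"
    using rational_functional_exists[of "{w}" w] w(1,2) by auto
  have lin: "linear g"
    using g(1) by (simp add: rational_functional_def)
  define \<rho> where "\<rho> = \<sigma> \<inter> {x. \<forall>f\<in>{g}. f x = 0}"
  have \<rho>: "polycone W \<rho>"
    unfolding \<rho>_def using g(1) by (intro polycone_Int assms(1) polycone_zeros) auto
  have mem: "x - g x *\<^sub>R w \<in> \<rho>" if "x \<in> \<sigma>" for x
  proof -
    have "(- g x) *\<^sub>R w \<in> \<sigma>"
      using w(3) span_scale[of w "{w}" "- g x"] by (auto simp: span_base)
    then have "x + (- g x) *\<^sub>R w \<in> \<sigma>"
      using convex_cone_add[OF cone that] by blast
    then show ?thesis
      using g(2) by (simp add: \<rho>_def linear_diff[OF lin] linear_scale[OF lin])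
  qed
  have "split_sum \<sigma> (span {w}) \<rho>"
    unfolding split_sum_def
  proof (intro conjI)
    show "span (span {w}) \<inter> span \<rho> \<subseteq> {0}"
    proof
      fix x assume x: "x \<in> span (span {w}) \<inter> span \<rho>"
      then have "g x = 0"
        using linear_eq_0_on_span[OF lin, of \<rho> x] by (auto simp: \<rho>_def)
      moreover obtain k where "x = k *\<^sub>R w"
        using x unfolding span_span by (auto simp: span_singleton)
      ultimately show "x \<in> {0}"
        using g(2) by (simp add: linear_scale[OF lin])
    qed
    show "\<sigma> = {a + b | a b. a \<in> span {w} \<and> b \<in> \<rho>}"
    proof (intro equalityI subsetI)
      fix x assume "x \<in> \<sigma>"
      then have "x = g x *\<^sub>R w + (x - g x *\<^sub>R w)" "g x *\<^sub>R w \<in> span {w}" "x - g x *\<^sub>R w \<in> \<rho>"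
        using mem by (auto intro: span_scale span_base)
      then show "x \<in> {a + b | a b. a \<in> span {w} \<and> b \<in> \<rho>}"
        by blast
    next
      fix x assume "x \<in> {a + b | a b. a \<in> span {w} \<and> b \<in> \<rho>}"
      then show "x \<in> \<sigma>"
        using w(3) convex_cone_add[OF cone] by (auto simp: \<rho>_def)
    qed
  qed
  moreover have "span {w} \<noteq> {0}"
    using w(2) span_base[of w "{w}"] by auto
  ultimately have "\<rho> = {0}"
    using assms(2) polycone_span_singleton[OF w(1,2)] \<rho> unfolding decomposable_iff by blast
  then have "x = g x *\<^sub>R w" if "x \<in> \<sigma>" for x
    using mem[OF that] by simp
  then have "\<sigma> = span {w}"
    using w(3) by (metis equalityI subsetI span_base span_scale singletonI)
  then show ?thesis
    using w(2) is_line_iff by blast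
qed

text \<open>A shear along a rational line of \<open>\<sigma>\<close> preserves \<open>\<sigma>\<close> but moves a decomposition.\<close>

lemma decomposition_not_unique:
  assumes "polycone W \<sigma>" "\<not> sharp \<sigma>" "\<not> is_line \<sigma>" and Z: "decomposition W \<sigma> Z"
  shows "\<exists>Z'. decomposition W \<sigma> Z' \<and> Z' \<noteq> Z"
proof -
  have cone: "convex_cone \<sigma>"
    using polycone_convex_cone[OF assms(1)] .
  obtain v where v: "v \<in> \<sigma>" "- v \<in> \<sigma>" "v \<noteq> 0"
    using assms(2) sharp_iff[OF cone] by blast
  obtain \<mu> a b where \<mu>: "\<mu> \<in> Z" "v = a + b" "a \<in> \<mu>" "a \<noteq> 0"
    and b: "b \<in> family_sum (Z - {\<mu>}) (\<lambda>\<tau>. \<tau>)"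
    using decomposition_component[OF Z v(1,3)] by metis
  note split = decomposition_split(1)[OF Z \<mu>(1)]
  \<comment> \<open>By directness the components of \<open>v\<close> and \<open>- v\<close> in \<mu>
    are opposite. As \<open>a\<close> is nonzero, the line contained in \<sigma> yields one
    contained in the member \<mu>.\<close>
  obtain a' b' where a': "- v = a' + b'" "a' \<in> \<mu>" "b' \<in> family_sum (Z - {\<mu>}) (\<lambda>\<tau>. \<tau>)"
    using v(2) split unfolding split_sum_def by blast
  have "a + a' \<in> span \<mu>"
    by (intro span_add span_base \<mu>(3) a'(2))
  moreover have "b + b' \<in> span (family_sum (Z - {\<mu>}) (\<lambda>\<tau>. \<tau>))"
    by (intro span_add span_base b a'(3))
  moreover have "(a + a') + (b + b') = 0"
    using \<mu>(2) a'(1) by (metis add.assoc add.left_commute add.right_inverse)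
  ultimately have "a + a' = 0"
    by (rule split_sum_eq_0(1)[OF split])
  then have "- a \<in> \<mu>"
    using a'(2) by (simp add: add_eq_0_iff)
  then obtain w where w: "w \<in> W" "w \<noteq> 0" "span {w} \<subseteq> \<mu>"
    using polycone_rational_line[OF decomposition_member(1)[OF Z \<mu>(1)] \<mu>(3) _ \<mu>(4)] by blast
  \<comment> \<open>If \<mu> were the only member, then \<sigma> would equal \<mu>, an
    indecomposable non-sharp polycone, and so would be a line.\<close>
  have "\<exists>\<tau>\<in>Z. \<tau> \<noteq> \<mu>"
  proof (rule ccontr)
    assume "\<not> (\<exists>\<tau>\<in>Z. \<tau> \<noteq> \<mu>)"
    then have "Z = {\<mu>}"
      using \<mu>(1) by blast
    then have "\<sigma> = \<mu>"
      using Z is_direct_sum_singleton[of "\<lambda>\<tau>. \<tau>" \<mu>] polycone_0[OF decomposition_member(1)[OF Z \<mu>(1)]]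
      by (simp add: decomposition_def is_direct_sum_def)
    then show False
      using indecomposable_line[OF assms(1) _ assms(2)] decomposition_member(2)[OF Z \<mu>(1)] assms(3) by simp
  qed
  then obtain \<tau> where \<tau>: "\<tau> \<in> Z" "\<tau> \<noteq> \<mu>"
    by blast
  \<comment> \<open>It suffices that \<open>u\<close> is in the span of \<tau>, because the final
    comparison is made between spans. Rationality of \<open>u\<close> and \<open>w\<close> allows a
    rational \<open>g\<close> separating them.\<close>
  obtain u where u: "u \<in> W" "u \<in> span \<tau>" "u \<noteq> 0"
    using polycone_rational_vector decomposition_member(1,3)[OF Z \<tau>(1)] by metis
  have w_span: "w \<in> span \<mu>"
    using w(3) by (auto intro!: span_base)
  have "span {w} \<subseteq> span \<mu>"
    using w(3) span_superset[of \<mu>] by blast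
  then have "u \<notin> span {w}"
    using direct_family_disjoint[OF decomposition_direct[OF Z] \<tau>(1) \<mu>(1) \<tau>(2) u(2)] u(3) by blast
  then have "independent {u, w}" "u \<noteq> w"
    using w(2) span_base[of w "{w}"] independent_insertI[of u "{w}"] by auto
  then obtain g where g: "rational_functional g" "g u = 1" "g w = 0"
    using rational_functional_exists[of "{u, w}" u] u(1) w(1) by auto
  have lin: "linear g" and gK: "\<And>x. x \<in> W \<Longrightarrow> g x \<in> K"
    using g(1) by (auto simp: rational_functional_def)
  \<comment> \<open>Since \<open>g w = 0\<close>, the shear fixes \<open>w\<close> and
    \<open>S\<close> inverts it; since \<open>g u = 1\<close>, it sends \<open>u\<close> to
    \<open>u + w\<close>. Values of \<open>g\<close> in \<open>K\<close> on \<open>W\<close> make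
    both maps preserve \<open>W\<close>.\<close>
  define T S where "T x = x + g x *\<^sub>R w" and "S x = x - g x *\<^sub>R w" for x
  have T: "linear T"
    unfolding T_def using lin by (intro linearI) (simp_all add: linear_add linear_scale algebra_simps)
  have S: "linear S"
    unfolding S_def using lin by (intro linearI) (simp_all add: linear_add linear_scale algebra_simps)
  have inv: "S (T x) = x" "T (S x) = x" for x
    using g(3) lin by (simp_all add: T_def S_def linear_add linear_diff linear_scale)
  have W': "T ` W \<subseteq> W" "S ` W \<subseteq> W"
    using w(1) gK by (auto simp: T_def S_def intro!: W_add W_scale W_diff_scale)
  \<comment> \<open>The line of \<open>w\<close> lies in \<mu> and hence in the cone \<sigma>, so
    \<sigma> is invariant under translation along it.\<close>
  have shift: "x + k *\<^sub>R w \<in> \<sigma>" if "x \<in> \<sigma>" for x k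
    using convex_cone_add[OF cone that] w(3) decomposition_member(4)[OF Z \<mu>(1)] span_scale[of w "{w}" k]
    by (auto simp: span_base)
  have "T ` \<sigma> = \<sigma>"
  proof
    show "T ` \<sigma> \<subseteq> \<sigma>"
      using shift by (auto simp: T_def)
    show "\<sigma> \<subseteq> T ` \<sigma>"
    proof
      fix x assume "x \<in> \<sigma>"
      then have "S x \<in> \<sigma>"
        using shift[of x "- g x"] by (simp add: S_def)
      then show "x \<in> T ` \<sigma>"
        using inv(2) by (metis imageI)
    qed
  qed
  then have Z': "decomposition W \<sigma> ((`) T ` Z)"
    using decomposition_image[OF T S W' inv Z] by simp
  \<comment> \<open>The span of the image contains \<open>u + w\<close>, which has nonzero
    components in both \<tau> and \<mu>.\<close>
  have "T ` \<tau> \<notin> Z"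
  proof
    assume "T ` \<tau> \<in> Z"
    moreover have "u + w \<in> span (T ` \<tau>)"
      using u(2) g(2) linear_span_image[OF T, of \<tau>] by (force simp: T_def)
    ultimately show False
      using direct_family_sum_notin[OF decomposition_direct[OF Z] \<tau>(1) \<mu>(1) _ \<tau>(2) u(2) w_span u(3) w(2)]
      by blast
  qed
  then show ?thesis
    using Z' \<tau>(1) by blast
qed

section \<open>Uniqueness for lines and for sharp polycones\<close>

lemma decomposition_line_unique:
  assumes "is_line \<sigma>" and Z: "decomposition W \<sigma> Z"
  shows "Z = {\<sigma>}"
proof -
  obtain v where v: "v \<noteq> 0" "\<sigma> = span {v}"
    using assms(1) is_line_iff by blast
  \<comment> \<open>A nonzero member inside the line of \<open>v\<close> already spans that line,
    and directness then leaves room for only one member.\<close>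
  have v_span: "v \<in> span \<tau>" if \<tau>: "\<tau> \<in> Z" for \<tau>
  proof -
    obtain w where w: "w \<in> \<tau>" "w \<noteq> 0"
      using decomposition_member(1,3)[OF Z \<tau>] polycone_0 by blast
    then obtain k where k: "w = k *\<^sub>R v"
      using decomposition_member(4)[OF Z \<tau>] v(2) by (auto simp: span_singleton)
    then have "inverse k *\<^sub>R w = v"
      using w(2) by simp
    then show ?thesis
      using w(1) by (metis span_base span_scale)
  qed
  then have single: "\<tau> = \<rho>" if "\<tau> \<in> Z" "\<rho> \<in> Z" for \<tau> \<rho>
    using direct_family_disjoint[OF decomposition_direct[OF Z] that] that v(1) by blast
  have "v \<in> \<sigma>"
    by (simp add: v(2) span_base)
  then obtain \<tau> where "\<tau> \<in> Z"
    using decomposition_component[OF Z _ v(1)] by metis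
  then have "Z = {\<tau>}"
    using single by blast
  moreover from this have "\<sigma> = \<tau>"
    using Z is_direct_sum_singleton[of "\<lambda>\<tau>. \<tau>" \<tau>] polycone_0[OF decomposition_member(1)[OF Z \<open>\<tau> \<in> Z\<close>]]
    by (simp add: decomposition_def is_direct_sum_def)
  ultimately show ?thesis
    by simp
qed

text \<open>Since \<tau> is a face of \<sigma>, it contains the components of its own elements with
  respect to \<rho> and to the sum \<open>R\<close> of the other members of \<open>Z'\<close>. So
  \<tau> is the direct sum of \<open>\<tau> \<inter> \<rho>\<close> and
  \<open>\<tau> \<inter> R\<close>. Choosing \<rho> so that some element of \<tau> has a nonzero
  component there makes the first summand nonzero, and indecomposability removes the second.\<close>

lemma decomposition_sharp_refine:
  assumes "polycone W \<sigma>" "sharp \<sigma>" and Z: "decomposition W \<sigma> Z" and Z': "decomposition W \<sigma> Z'"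
    and \<tau>: "\<tau> \<in> Z"
  shows "\<exists>\<rho>\<in>Z'. \<tau> \<subseteq> \<rho>"
proof -
  have pointed: "\<forall>v\<in>\<sigma>. - v \<in> \<sigma> \<longrightarrow> v = 0"
    using assms(2) sharp_iff[OF polycone_convex_cone[OF assms(1)]] by blast
  note pc\<tau> = decomposition_member(1)[OF Z \<tau>]
  have \<tau>_face: "a \<in> \<tau>" "b \<in> \<tau>" if "a \<in> \<sigma>" "b \<in> \<sigma>" "a + b \<in> \<tau>" for a b
    using split_sum_face[OF decomposition_split(1)[OF Z \<tau>] polycone_convex_cone[OF pc\<tau>]
      decomposition_split(2)[OF Z \<tau>] pointed] that by (blast, metis add.commute)
  obtain x where x: "x \<in> \<tau>" "x \<noteq> 0"
    using decomposition_member(3)[OF Z \<tau>] polycone_0[OF pc\<tau>] by blast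
  have \<tau>\<sigma>: "\<tau> \<subseteq> \<sigma>"
    using decomposition_member(4)[OF Z \<tau>] .
  obtain \<rho> a b where \<rho>: "\<rho> \<in> Z'" and ab: "x = a + b" "a \<in> \<rho>" "a \<noteq> 0"
    "b \<in> family_sum (Z' - {\<rho>}) (\<lambda>\<tau>. \<tau>)"
    using decomposition_component[OF Z' _ x(2)] x(1) \<tau>\<sigma> by blast
  define R where "R = family_sum (Z' - {\<rho>}) (\<lambda>\<tau>. \<tau>)"
  have split: "split_sum \<sigma> \<rho> R" and R: "convex_cone R"
    using decomposition_split[OF Z' \<rho>] by (auto simp: R_def)
  note pc\<rho> = decomposition_member(1)[OF Z' \<rho>]
  have sub: "\<rho> \<subseteq> \<sigma>" "R \<subseteq> \<sigma>"
    using split_sum_subset[OF split] split_sum_subset[OF split_sum_commute[OF split]] R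
      polycone_0[OF pc\<rho>] by (auto simp: convex_cone_iff)
  \<comment> \<open>\<open>R\<close> is known only as a convex cone, so closure under intersection
    does not apply. Instead the intersection is a face of \<tau>, because \<open>R\<close> is a
    direct summand of the sharp cone \<sigma>.\<close>
  have "polycone W (\<tau> \<inter> R)"
  proof (rule polycone_face[OF pc\<tau>])
    show "convex_cone (\<tau> \<inter> R)"
      using R polycone_convex_cone[OF pc\<tau>] by (simp add: convex_cone_iff)
    show "p \<in> \<tau> \<inter> R" if "p \<in> \<tau>" "q \<in> \<tau>" "p + q \<in> \<tau> \<inter> R" for p q
      using split_sum_face[OF split_sum_commute[OF split] R polycone_convex_cone[OF pc\<rho>] pointed] that \<tau>\<sigma>
      by blast
  qed auto
  moreover have "polycone W (\<tau> \<inter> \<rho>)"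
    using polycone_Int[OF pc\<tau> pc\<rho>] .
  \<comment> \<open>The nonzero component \<open>a\<close> of \<open>x\<close> lies in \<rho> by
    choice and in \<tau> by the face property.\<close>
  moreover have "\<tau> \<inter> \<rho> \<noteq> {0}"
    using \<tau>_face(1)[of a b] ab x(1) sub by (auto simp: R_def)
  moreover have components: "\<exists>p\<in>\<tau> \<inter> \<rho>. \<exists>q\<in>\<tau> \<inter> R. y = p + q" if y: "y \<in> \<tau>" for y
  proof -
    obtain p q where "y = p + q" "p \<in> \<rho>" "q \<in> R"
      using y \<tau>\<sigma> split unfolding split_sum_def by blast
    then show ?thesis
      using \<tau>_face[of p q] y sub by blast
  qed
  moreover have "split_sum \<tau> (\<tau> \<inter> \<rho>) (\<tau> \<inter> R)"
    unfolding split_sum_def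
  proof
    show "span (\<tau> \<inter> \<rho>) \<inter> span (\<tau> \<inter> R) \<subseteq> {0}"
      using split span_mono[of "\<tau> \<inter> \<rho>" \<rho>] span_mono[of "\<tau> \<inter> R" R] unfolding split_sum_def by blast
    show "\<tau> = {a + b | a b. a \<in> \<tau> \<inter> \<rho> \<and> b \<in> \<tau> \<inter> R}"
      using components convex_cone_add[OF polycone_convex_cone[OF pc\<tau>]] by blast
  qed
  ultimately have "\<tau> \<inter> R = {0}"
    using decomposition_member(2)[OF Z \<tau>] unfolding decomposable_iff by blast
  then have "\<tau> \<subseteq> \<rho>"
    using components by fastforce
  then show ?thesis
    using \<rho> by blast
qed

text \<open>Refining in both directions gives
  \<open>\<tau> \<subseteq> \<rho> \<subseteq> \<kappa>\<close> with \<tau> and \<kappa> in the same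
  direct family. They share a nonzero vector, so they are equal, and \<rho> between them is
  \<tau>.\<close>

lemma decomposition_sharp_subset:
  assumes "polycone W \<sigma>" "sharp \<sigma>" and Z: "decomposition W \<sigma> Z" and Z': "decomposition W \<sigma> Z'"
  shows "Z \<subseteq> Z'"
proof
  fix \<tau> assume \<tau>: "\<tau> \<in> Z"
  obtain \<rho> where \<rho>: "\<rho> \<in> Z'" "\<tau> \<subseteq> \<rho>"
    using decomposition_sharp_refine[OF assms \<tau>] by blast
  obtain \<kappa> where \<kappa>: "\<kappa> \<in> Z" "\<rho> \<subseteq> \<kappa>"
    using decomposition_sharp_refine[OF assms(1,2) Z' Z \<rho>(1)] by blast
  obtain x where x: "x \<in> \<tau>" "x \<noteq> 0"
    using decomposition_member(1,3)[OF Z \<tau>] polycone_0 by blast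
  have "x \<in> span \<tau>" "x \<in> span \<kappa>"
    using x(1) \<rho>(2) \<kappa>(2) by (auto intro!: span_base)
  then have "\<tau> = \<kappa>"
    using direct_family_disjoint[OF decomposition_direct[OF Z] \<tau> \<kappa>(1)] x(2) by blast
  then show "\<tau> \<in> Z'"
    using \<rho> \<kappa>(2) by auto
qed

lemma decomposition_unique_iff:
  assumes "polycone W \<sigma>"
  shows "(\<exists>!Z. decomposition W \<sigma> Z) \<longleftrightarrow> sharp \<sigma> \<or> is_line \<sigma>"
proof
  assume "\<exists>!Z. decomposition W \<sigma> Z"
  then show "sharp \<sigma> \<or> is_line \<sigma>"
    using decomposition_not_unique[OF assms] by blast
next
  assume "sharp \<sigma> \<or> is_line \<sigma>"
  then have "Z = Z'" if "decomposition W \<sigma> Z" "decomposition W \<sigma> Z'" for Z Z'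
    using decomposition_sharp_subset[OF assms] decomposition_line_unique that by blast
  then show "\<exists>!Z. decomposition W \<sigma> Z"
    using decomposition_exists[OF assms] by blast
qed

end

theorem mainTheorem4:
  fixes K :: "real set" and W :: "'a::real_vector set"
  assumes "\<exists>B::'a set. finite B \<and> span B = UNIV"
    and "is_subfield K"
    and "K_structure K W"
  shows "(\<forall>\<sigma>. polycone W \<sigma> \<longrightarrow> (\<exists>Z. decomposition W \<sigma> Z)) \<and>
         (\<forall>\<sigma>. polycone W \<sigma> \<longrightarrow> ((\<exists>!Z. decomposition W \<sigma> Z) \<longleftrightarrow> sharp \<sigma> \<or> is_line \<sigma>))"
proof -
  interpret rational_structure K W
    using assms K_structure_span[OF assms(3)] K_structure_coefficients[OF assms(2,3)]
    by unfold_locales (auto simp: K_structure_def)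
  show ?thesis
    using decomposition_exists decomposition_unique_iff by blast
qed

end
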